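(* Let $n \geq 2$. The restriction map $r : \mathrm{Aut}(\mathcal{O}_n,\mathcal{F}_n) \to \mathrm{Aut}(\mathcal{F}_n)$, $r(\beta) = \beta|_{\mathcal{F}_n}$, is not surjective. Moreover, there are strict inclusions $$\mathrm{Inn}(\mathcal{F}_n) \subsetneq r\big(\mathrm{Aut}(\mathcal{O}_n,\mathcal{F}_n)\big) \subsetneq \mathrm{Aut}(\mathcal{F}_n).$$
   Context: For an integer $n \geq 2$, the Cuntz algebra $\mathcal{O}_n$ is the universal unital $C^*$-algebra generated by isometries $S_1,\ldots,S_n$ with $\sum_{i=1}^n S_iS_i^*=1$. For $k \geq 1$, $\mathcal{F}_n^k = \mathrm{span}\{S_{\alpha_1}\cdots S_{\alpha_k}S_{\beta_k}^*\cdots S_{\beta_1}^* : 1 \leq \alpha_j,\beta_j \leq n\} \simeq M_n^{\otimes k}$, and the core UHF-subalgebra $\mathcal{F}_n$ is the norm closure of $\bigcup_k \mathcal{F}_n^k$ (a UHF algebra of type $n^\infty$). For a unital $C^*$-algebra $B$, $\mathrm{Aut}(B)$ and $\mathrm{Inn}(B)$ are the groups of $*$-automorphisms and of inner automorphisms ($\mathrm{Ad}(u)$ with $u \in B$ unitary) of $B$. $\mathrm{Aut}(\mathcal{O}_n,\mathcal{F}_n)$ is the group of automorphisms $\beta$ of $\mathcal{O}_n$ leaving $\mathcal{F}_n$ globally invariant, i.e. $\beta(\mathcal{F}_n)=\mathcal{F}_n$. *)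

theory Defs
  imports
    "HOL-Analysis.Abstract_Metric_Spaces"
    "HOL-Algebra.Module"
    "HOL-Algebra.Subrings"
    "HOL-Algebra.Bij"
begin

subsection \<open>Unital C*-algebras\<close>

definition complex_ring :: "complex ring" where
  "complex_ring = \<lparr>carrier = UNIV, mult = (*), one = 1, zero = 0, add = (+)\<rparr>"

record 'a cstar = "(complex, 'a) module" +
  adj :: "'a \<Rightarrow> 'a"
  nrm :: "'a \<Rightarrow> real"

text \<open>The value outside the carrier is immaterial; it is fixed so that the locale
  \<^locale>\<open>Metric_space\<close>, which asks for symmetry and positivity everywhere, applies.\<close>

definition cstar_dist :: "'a cstar \<Rightarrow> 'a \<Rightarrow> 'a \<Rightarrow> real" where
  "cstar_dist A x y =
     (if x \<in> carrier A \<and> y \<in> carrier A then nrm A (x \<ominus>\<^bsub>A\<^esub> y) else 0)"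

definition norm_topology :: "'a cstar \<Rightarrow> 'a topology" where
  "norm_topology A = Metric_space.mtopology (carrier A) (cstar_dist A)"

text \<open>The zero algebra is excluded by \<open>one_not_zero\<close>.\<close>

locale unital_cstar_algebra =
  module complex_ring A + ring A for A :: "'a cstar" (structure) +
  assumes one_not_zero: "\<one> \<noteq> \<zero>"
    and smult_mult_left:
      "\<lbrakk>x \<in> carrier A; y \<in> carrier A\<rbrakk> \<Longrightarrow> (c \<odot> x) \<otimes> y = c \<odot> (x \<otimes> y)"
    and smult_mult_right:
      "\<lbrakk>x \<in> carrier A; y \<in> carrier A\<rbrakk> \<Longrightarrow> x \<otimes> (c \<odot> y) = c \<odot> (x \<otimes> y)"
    and adj_closed: "x \<in> carrier A \<Longrightarrow> adj A x \<in> carrier A"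
    and adj_adj: "x \<in> carrier A \<Longrightarrow> adj A (adj A x) = x"
    and adj_add:
      "\<lbrakk>x \<in> carrier A; y \<in> carrier A\<rbrakk> \<Longrightarrow> adj A (x \<oplus> y) = adj A x \<oplus> adj A y"
    and adj_smult: "x \<in> carrier A \<Longrightarrow> adj A (c \<odot> x) = cnj c \<odot> adj A x"
    and adj_mult:
      "\<lbrakk>x \<in> carrier A; y \<in> carrier A\<rbrakk> \<Longrightarrow> adj A (x \<otimes> y) = adj A y \<otimes> adj A x"
    and nrm_nonneg: "x \<in> carrier A \<Longrightarrow> 0 \<le> nrm A x"
    and nrm_eq_zero: "x \<in> carrier A \<Longrightarrow> nrm A x = 0 \<longleftrightarrow> x = \<zero>"
    and nrm_triangle:
      "\<lbrakk>x \<in> carrier A; y \<in> carrier A\<rbrakk> \<Longrightarrow> nrm A (x \<oplus> y) \<le> nrm A x + nrm A y"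
    and nrm_smult: "x \<in> carrier A \<Longrightarrow> nrm A (c \<odot> x) = cmod c * nrm A x"
    and nrm_mult:
      "\<lbrakk>x \<in> carrier A; y \<in> carrier A\<rbrakk> \<Longrightarrow> nrm A (x \<otimes> y) \<le> nrm A x * nrm A y"
    and nrm_complete: "Metric_space.mcomplete (carrier A) (cstar_dist A)"
    and cstar_identity: "x \<in> carrier A \<Longrightarrow> nrm A (adj A x \<otimes> x) = (nrm A x)\<^sup>2"

text \<open>Unital \<open>*\<close>-homomorphisms; \<^const>\<open>ring_hom\<close> includes preservation of the unit.\<close>

definition star_hom :: "'a cstar \<Rightarrow> 'b cstar \<Rightarrow> ('a \<Rightarrow> 'b) set" where
  "star_hom A B = {h \<in> ring_hom A B.
     (\<forall>c. \<forall>x\<in>carrier A. h (c \<odot>\<^bsub>A\<^esub> x) = c \<odot>\<^bsub>B\<^esub> h x) \<and>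
     (\<forall>x\<in>carrier A. h (adj A x) = adj B (h x))}"

definition cstar_subalgebra :: "'a set \<Rightarrow> 'a cstar \<Rightarrow> bool" where
  "cstar_subalgebra H A \<longleftrightarrow> subring H A \<and>
     (\<forall>c. \<forall>x\<in>H. c \<odot>\<^bsub>A\<^esub> x \<in> H) \<and> (\<forall>x\<in>H. adj A x \<in> H) \<and> closedin (norm_topology A) H"

definition cstar_generated :: "'a cstar \<Rightarrow> 'a set \<Rightarrow> 'a set" where
  "cstar_generated A X = \<Inter>{H. cstar_subalgebra H A \<and> X \<subseteq> H}"

definition unitaries :: "'a cstar \<Rightarrow> 'a set" where
  "unitaries A = {u \<in> carrier A. adj A u \<otimes>\<^bsub>A\<^esub> u = \<one>\<^bsub>A\<^esub> \<and> u \<otimes>\<^bsub>A\<^esub> adj A u = \<one>\<^bsub>A\<^esub>}"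

definition complex_span :: "'a cstar \<Rightarrow> 'a set \<Rightarrow> 'a set" where
  "complex_span A X =
     {(\<Oplus>\<^bsub>A\<^esub>x\<in>Y. c x \<odot>\<^bsub>A\<^esub> x) | c Y. finite Y \<and> Y \<subseteq> X}"


subsection \<open>Automorphisms\<close>

text \<open>As in \<^const>\<open>Bij\<close>, maps are extensional, so that equality of automorphisms is
  equality on the carrier.\<close>

definition Aut :: "'a cstar \<Rightarrow> ('a \<Rightarrow> 'a) set" where
  "Aut A = star_hom A A \<inter> Bij (carrier A)"

definition Ad :: "'a cstar \<Rightarrow> 'a \<Rightarrow> 'a \<Rightarrow> 'a" where
  "Ad A u = (\<lambda>x\<in>carrier A. u \<otimes>\<^bsub>A\<^esub> x \<otimes>\<^bsub>A\<^esub> adj A u)"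

definition Inn :: "'a cstar \<Rightarrow> ('a \<Rightarrow> 'a) set" where
  "Inn A = Ad A ` unitaries A"

definition Aut_pair :: "'a cstar \<Rightarrow> 'a cstar \<Rightarrow> ('a \<Rightarrow> 'a) set" where
  "Aut_pair A F = {\<beta> \<in> Aut A. \<beta> ` carrier F = carrier F}"

definition restriction_map :: "'a cstar \<Rightarrow> ('a \<Rightarrow> 'a) \<Rightarrow> ('a \<Rightarrow> 'a)" where
  "restriction_map F \<beta> = restrict \<beta> (carrier F)"


subsection \<open>Cuntz algebras and their core\<close>

locale cuntz_family = unital_cstar_algebra A
  for n :: nat and A :: "'a cstar" (structure) and S :: "nat \<Rightarrow> 'a" +
  assumes gen_closed: "i \<in> {1..n} \<Longrightarrow> S i \<in> carrier A"
    and isometry: "i \<in> {1..n} \<Longrightarrow> adj A (S i) \<otimes> S i = \<one>"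
    and range_sum: "(\<Oplus>i\<in>{1..n}. S i \<otimes> adj A (S i)) = \<one>"

text \<open>
  The universal property quantifies over all unital C*-algebras whose carrier is a set of
  elements of the type \<^typ>\<open>'a\<close>, since HOL cannot quantify over types here. Nothing is lost:
  a homomorphism sending \<open>S\<^sub>i\<close> to \<open>T\<^sub>i\<close> lands in the C*-algebra generated by the \<open>T\<^sub>i\<close>, which
  is separable and so has at most the cardinality of the continuum, while \<^typ>\<open>'a\<close> contains the
  nonzero complex vector space \<open>carrier A\<close>. So that algebra has a copy carried by \<^typ>\<open>'a\<close>.
  Uniqueness of the homomorphism follows from \<open>generated\<close>.
\<close>

locale cuntz_algebra = cuntz_family n A S
  for n :: nat and A :: "'a cstar" (structure) and S :: "nat \<Rightarrow> 'a" +
  assumes generated: "carrier A = cstar_generated A (S ` {1..n})"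
    and universal: "\<And>(B :: 'a cstar) T. cuntz_family n B T \<Longrightarrow>
          \<exists>h \<in> star_hom A B. \<forall>i\<in>{1..n}. h (S i) = T i"

definition gen_word :: "'a cstar \<Rightarrow> (nat \<Rightarrow> 'a) \<Rightarrow> nat list \<Rightarrow> 'a" where
  "gen_word A S w = foldr (\<lambda>i x. S i \<otimes>\<^bsub>A\<^esub> x) w \<one>\<^bsub>A\<^esub>"

definition matrix_level :: "nat \<Rightarrow> 'a cstar \<Rightarrow> (nat \<Rightarrow> 'a) \<Rightarrow> nat \<Rightarrow> 'a set" where
  "matrix_level n A S k = complex_span A
     {gen_word A S \<alpha> \<otimes>\<^bsub>A\<^esub> adj A (gen_word A S \<beta>) | \<alpha> \<beta>.
        length \<alpha> = k \<and> length \<beta> = k \<and> set \<alpha> \<subseteq> {1..n} \<and> set \<beta> \<subseteq> {1..n}}"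

definition core :: "nat \<Rightarrow> 'a cstar \<Rightarrow> (nat \<Rightarrow> 'a) \<Rightarrow> 'a cstar" where
  "core n A S =
     A\<lparr>carrier := norm_topology A closure_of (\<Union>k\<in>{1..}. matrix_level n A S k)\<rparr>"


subsection \<open>Basic facts\<close>

lemma cring_complex_ring: "cring complex_ring"
proof (rule cringI)
  show "abelian_group complex_ring"
  proof (rule abelian_groupI)
    fix x :: complex
    show "\<exists>y\<in>carrier complex_ring. y \<oplus>\<^bsub>complex_ring\<^esub> x = \<zero>\<^bsub>complex_ring\<^esub>"
      by (intro bexI[of _ "- x"]) (auto simp: complex_ring_def)
  qed (auto simp: complex_ring_def)
  show "comm_monoid complex_ring"
    by (rule comm_monoidI) (auto simp: complex_ring_def)
qed (auto simp: complex_ring_def algebra_simps)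

context unital_cstar_algebra
begin

lemma nrm_minus: "x \<in> carrier A \<Longrightarrow> nrm A (\<ominus> x) = nrm A x"
proof -
  assume x: "x \<in> carrier A"
  have c: "(-1 :: complex) \<in> carrier complex_ring" "(1 :: complex) \<in> carrier complex_ring"
    by (auto simp: complex_ring_def)
  have cl: "(-1) \<odot> x \<in> carrier A" using c x by blast
  have z: "(0::complex) \<odot> x = \<zero>"
    using x nrm_smult[of x 0] nrm_eq_zero[of "(0::complex) \<odot> x"] smult_closed[of 0 x]
    by (auto simp: complex_ring_def)
  have "(-1) \<odot> x \<oplus> x = (0::complex) \<odot> x"
    using smult_l_distr[OF c x] smult_one[OF x] by (simp add: complex_ring_def)
  with z have "(-1) \<odot> x \<oplus> x = \<zero>" by simp
  then have "\<ominus> x = (-1) \<odot> x" using minus_equality cl x by blast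
  then show ?thesis using nrm_smult[OF x, of "-1"] by simp
qed

lemma Metric_space_cstar: "Metric_space (carrier A) (cstar_dist A)"
proof
  fix x y z
  show "0 \<le> cstar_dist A x y" by (auto simp: cstar_dist_def nrm_nonneg)
  show "cstar_dist A x y = cstar_dist A y x"
  proof (cases "x \<in> carrier A \<and> y \<in> carrier A")
    case True
    then have "\<ominus> (x \<ominus> y) = y \<ominus> x" by (simp add: minus_eq minus_add a_comm)
    then show ?thesis using True nrm_minus[of "x \<ominus> y"] by (simp add: cstar_dist_def)
  qed (auto simp: cstar_dist_def)
  assume xy: "x \<in> carrier A" "y \<in> carrier A"
  then show "cstar_dist A x y = 0 \<longleftrightarrow> x = y"
    by (simp add: cstar_dist_def nrm_eq_zero)
  assume z: "z \<in> carrier A"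
  have "x \<ominus> z = (x \<ominus> y) \<oplus> (y \<ominus> z)" using xy z
    by (simp add: minus_eq a_assoc r_neg1)
  then show "cstar_dist A x z \<le> cstar_dist A x y + cstar_dist A y z"
    using xy z nrm_triangle[of "x \<ominus> y" "y \<ominus> z"] by (simp add: cstar_dist_def)
qed

end

end

theory Submission
  imports Defs
begin

text \<open>
  Put \<open>e = S\<^sub>1S\<^sub>2\<^sup>* + S\<^sub>2S\<^sub>1\<^sup>*\<close>, let \<open>\<phi>(x) = \<Sum>\<^sub>i S\<^sub>ixS\<^sub>i\<^sup>*\<close> be the canonical shift and \<open>e\<^sub>k = \<phi>\<^sup>k(e)\<close>.
  With \<open>\<xi> = S\<^sub>1 + S\<^sub>2\<close> one has \<open>e\<^sub>j\<xi>\<^sup>N = \<xi>\<^sup>N\<close> for \<open>j < N\<close>. A polynomial \<open>T\<close> in the generators and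
  their adjoints moves the index of \<open>e\<^sub>k\<close> by a bounded amount, so \<open>e\<^sub>kT\<xi>\<^sup>N = T\<xi>\<^sup>N\<close> for \<open>k\<close> large and
  \<open>N\<close> much larger. By density no isometry \<open>T\<close> satisfies \<open>Te\<^sub>k = - e\<^sub>k\<^sub>+\<^sub>cT\<close> for infinitely many \<open>k\<close>.

  For \<open>c = 0\<close> this shows that the automorphism \<open>S\<^sub>1 \<mapsto> - S\<^sub>1\<close>, \<open>S\<^sub>i \<mapsto> S\<^sub>i\<close> (\<open>i > 1\<close>), which maps each \<open>e\<^sub>k\<close>
  to \<open>- e\<^sub>k\<close>, is not inner on the core. For \<open>c = 1\<close>, let \<open>\<alpha>\<close> be the product type automorphism of the
  core that acts by \<open>Ad (1 - 2S\<^sub>1S\<^sub>1\<^sup>*)\<close> on every second tensor factor, so that \<open>\<alpha>(e\<^sub>k) = (-1)\<^sup>k e\<^sub>k\<close>.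
  If \<open>\<beta>\<close> extended \<open>\<alpha>\<close>, then applying \<open>\<beta>\<close> to \<open>S\<^sub>1e\<^sub>k = e\<^sub>k\<^sub>+\<^sub>1S\<^sub>1\<close> would show that \<open>T = \<beta>(S\<^sub>1)\<close> satisfies the
  forbidden relation for all even \<open>k\<close>.
\<close>

section \<open>Norm limits in unital C*-algebras\<close>

context unital_cstar_algebra
begin

lemma complex_ring_simps [simp]:
  "carrier complex_ring = UNIV" "mult complex_ring = (*)" "one complex_ring = 1"
  "zero complex_ring = 0" "add complex_ring = (+)"
  by (auto simp: complex_ring_def)

lemma smult_zero_one [simp]:
  "x \<in> carrier A \<Longrightarrow> 0 \<odot> x = \<zero>" "x \<in> carrier A \<Longrightarrow> 1 \<odot> x = x"
  using smult_l_null[of x] smult_one[of x] by simp_all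

lemma minus_one_smult: "x \<in> carrier A \<Longrightarrow> (-1) \<odot> x = \<ominus> x"
proof -
  assume x: "x \<in> carrier A"
  have "(-1) \<odot> x \<oplus> x = \<zero>"
    using smult_l_distr[of "-1" 1 x] smult_l_null[OF x] smult_one[OF x] x by simp
  then show ?thesis using minus_equality[of "(-1) \<odot> x" x] x by simp
qed

lemma adj_zero [simp]: "adj A \<zero> = \<zero>"
  using adj_smult[of \<zero> 0] adj_closed[of \<zero>] smult_l_null by force

lemma adj_one [simp]: "adj A \<one> = \<one>"
  using adj_mult[of "adj A \<one>" \<one>] adj_adj[of \<one>] adj_closed[of \<one>] by simp

lemma adj_minus: "x \<in> carrier A \<Longrightarrow> adj A (\<ominus> x) = \<ominus> adj A x"
  using adj_smult[of x "-1"] by (simp add: minus_one_smult adj_closed)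

lemma adj_diff:
  "\<lbrakk>x \<in> carrier A; y \<in> carrier A\<rbrakk> \<Longrightarrow> adj A (x \<ominus> y) = adj A x \<ominus> adj A y"
  by (simp add: minus_eq adj_add adj_minus)

lemma nrm_zero [simp]: "nrm A \<zero> = 0"
  using nrm_eq_zero by simp

lemma nrm_one [simp]: "nrm A \<one> = 1"
proof -
  have "nrm A \<one> = (nrm A \<one>)\<^sup>2" using cstar_identity[of \<one>] by simp
  moreover have "nrm A \<one> \<noteq> 0" using nrm_eq_zero one_not_zero by simp
  ultimately show ?thesis by (simp add: power2_eq_square)
qed

lemma nrm_adj [simp]: "x \<in> carrier A \<Longrightarrow> nrm A (adj A x) = nrm A x"
proof -
  have *: "nrm A x \<le> nrm A (adj A x)" if x: "x \<in> carrier A" for x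
  proof (cases "nrm A x = 0")
    case False
    have "nrm A x * nrm A x \<le> nrm A (adj A x) * nrm A x"
      using cstar_identity[OF x] nrm_mult[OF adj_closed[OF x] x] by (simp add: power2_eq_square)
    then show ?thesis using False nrm_nonneg[OF x] by simp
  qed (use nrm_nonneg[OF adj_closed[OF x]] in simp)
  show "x \<in> carrier A \<Longrightarrow> nrm A (adj A x) = nrm A x"
    using *[of x] *[of "adj A x"] by (simp add: adj_closed adj_adj)
qed

lemma nrm_diff_triangle:
  "\<lbrakk>x \<in> carrier A; y \<in> carrier A\<rbrakk> \<Longrightarrow> nrm A (x \<ominus> y) \<le> nrm A x + nrm A y"
  using nrm_triangle[of x "\<ominus> y"] by (simp add: minus_eq nrm_minus)

lemma nrm_diff_commute:
  "\<lbrakk>x \<in> carrier A; y \<in> carrier A\<rbrakk> \<Longrightarrow> nrm A (x \<ominus> y) = nrm A (y \<ominus> x)"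
  using Metric_space.commute[OF Metric_space_cstar, of x y] by (simp add: cstar_dist_def)

lemma nrm_diff_trans:
  "\<lbrakk>x \<in> carrier A; y \<in> carrier A; z \<in> carrier A\<rbrakk> \<Longrightarrow>
     nrm A (x \<ominus> z) \<le> nrm A (x \<ominus> y) + nrm A (y \<ominus> z)"
  using Metric_space.triangle[OF Metric_space_cstar, of x y z] by (simp add: cstar_dist_def)

text \<open>The factor \<open>adj A v \<otimes> v\<close> cancels inside the C*-identity for the
  product.\<close>

lemma nrm_isometry_mult:
  assumes "v \<in> carrier A" "x \<in> carrier A" "adj A v \<otimes> v = \<one>"
  shows "nrm A (v \<otimes> x) = nrm A x"
proof -
  have "adj A (v \<otimes> x) \<otimes> (v \<otimes> x) = adj A x \<otimes> ((adj A v \<otimes> v) \<otimes> x)"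
    using assms(1,2) by (simp add: adj_mult adj_closed m_assoc)
  then have "(nrm A (v \<otimes> x))\<^sup>2 = (nrm A x)\<^sup>2"
    using assms cstar_identity[of x] cstar_identity[of "v \<otimes> x"] by simp
  then show ?thesis using assms nrm_nonneg[of x] nrm_nonneg[of "v \<otimes> x"] by (simp add: power2_eq_iff_nonneg)
qed

lemma nrm_isometry: "\<lbrakk>v \<in> carrier A; adj A v \<otimes> v = \<one>\<rbrakk> \<Longrightarrow> nrm A v = 1"
  using nrm_isometry_mult[of v \<one>] by simp

text \<open>For a projection the C*-identity reads |p|^2 = |p|, so the norm is 0 or 1.\<close>

lemma nrm_projection_le:
  assumes "p \<in> carrier A" "adj A p = p" "p \<otimes> p = p"
  shows "nrm A p \<le> 1"
proof -
  have "nrm A p * nrm A p = nrm A p" using assms cstar_identity[of p] by (simp add: power2_eq_square)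
  then show ?thesis by auto
qed

section \<open>Sequential convergence in norm\<close>

definition tends :: "(nat \<Rightarrow> 'a) \<Rightarrow> 'a \<Rightarrow> bool" where
  "tends f l \<longleftrightarrow> l \<in> carrier A \<and> (\<forall>k. f k \<in> carrier A) \<and> (\<lambda>k. nrm A (f k \<ominus> l)) \<longlonglongrightarrow> 0"

lemma tendsI_le:
  assumes "l \<in> carrier A" "\<And>k. f k \<in> carrier A"
    and "\<And>k. nrm A (f k \<ominus> l) \<le> g k" "g \<longlonglongrightarrow> (0::real)"
  shows "tends f l"
  unfolding tends_def
proof (intro conjI allI)
  show "(\<lambda>k. nrm A (f k \<ominus> l)) \<longlonglongrightarrow> 0"
    by (rule tendsto_sandwich[OF _ _ tendsto_const assms(4)])
      (use assms in \<open>auto intro!: always_eventually nrm_nonneg\<close>)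
qed (use assms in auto)

lemma tends_const: "x \<in> carrier A \<Longrightarrow> tends (\<lambda>k. x) x"
  by (simp add: tends_def r_neg minus_eq)

lemma tends_add:
  assumes "tends f x" "tends g y"
  shows "tends (\<lambda>k. f k \<oplus> g k) (x \<oplus> y)"
proof (rule tendsI_le)
  fix k
  have c: "f k \<in> carrier A" "g k \<in> carrier A" "x \<in> carrier A" "y \<in> carrier A"
    using assms by (auto simp: tends_def)
  have "f k \<oplus> g k \<ominus> (x \<oplus> y) = (f k \<ominus> x) \<oplus> (g k \<ominus> y)" using c by algebra
  then show "nrm A (f k \<oplus> g k \<ominus> (x \<oplus> y)) \<le> nrm A (f k \<ominus> x) + nrm A (g k \<ominus> y)"
    using nrm_triangle c by simp
next
  show "(\<lambda>k. nrm A (f k \<ominus> x) + nrm A (g k \<ominus> y)) \<longlonglongrightarrow> 0"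
    using tendsto_add[of _ 0 sequentially _ 0] assms by (auto simp: tends_def)
qed (use assms in \<open>auto simp: tends_def\<close>)

lemma tends_smult:
  assumes "tends f x"
  shows "tends (\<lambda>k. c \<odot> f k) (c \<odot> x)"
proof (rule tendsI_le)
  fix k
  have cl: "f k \<in> carrier A" "x \<in> carrier A"
    using assms by (auto simp: tends_def)
  have "c \<odot> f k \<ominus> c \<odot> x = c \<odot> (f k \<ominus> x)" using cl by (simp add: minus_eq smult_r_distr smult_r_minus)
  then show "nrm A (c \<odot> f k \<ominus> c \<odot> x) \<le> cmod c * nrm A (f k \<ominus> x)"
    using cl by (simp add: nrm_smult)
next
  show "(\<lambda>k. cmod c * nrm A (f k \<ominus> x)) \<longlonglongrightarrow> 0"
    using tendsto_mult_right_zero assms by (auto simp: tends_def)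
qed (use assms in \<open>auto simp: tends_def\<close>)

lemma tends_adj:
  assumes "tends f x"
  shows "tends (\<lambda>k. adj A (f k)) (adj A x)"
proof (rule tendsI_le)
  show "(\<lambda>k. nrm A (f k \<ominus> x)) \<longlonglongrightarrow> 0" using assms by (auto simp: tends_def)
  fix k
  have cl: "f k \<in> carrier A" "x \<in> carrier A"
    using assms by (auto simp: tends_def)
  show "nrm A (adj A (f k) \<ominus> adj A x) \<le> nrm A (f k \<ominus> x)"
    using cl by (simp flip: adj_diff)
qed (use assms in \<open>auto simp: tends_def adj_closed\<close>)

lemma tends_nrm: "tends f x \<Longrightarrow> (\<lambda>k. nrm A (f k)) \<longlonglongrightarrow> nrm A x"
proof (rule LIM_zero_cancel, rule tendsto_rabs_zero_cancel)
  assume t: "tends f x"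
  have *: "nrm A a \<le> nrm A b + nrm A (a \<ominus> b)" if "a \<in> carrier A" "b \<in> carrier A" for a b
  proof -
    have "a = b \<oplus> (a \<ominus> b)" using that by algebra
    then show ?thesis using nrm_triangle[of b "a \<ominus> b"] that by simp
  qed
  have "\<bar>nrm A (f k) - nrm A x\<bar> \<le> nrm A (f k \<ominus> x)" for k
    using t *[of "f k" x] *[of x "f k"] nrm_diff_commute[of x "f k"] by (auto simp: tends_def)
  then have ev: "\<forall>\<^sub>F k in sequentially. norm \<bar>nrm A (f k) - nrm A x\<bar> \<le> nrm A (f k \<ominus> x)"
    by (intro always_eventually allI) (simp only: real_norm_def abs_idempotent)
  show "(\<lambda>k. \<bar>nrm A (f k) - nrm A x\<bar>) \<longlonglongrightarrow> 0"
    using t by (intro Lim_null_comparison[OF ev]) (simp add: tends_def)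
qed

lemma tends_mult:
  assumes "tends f x" "tends g y"
  shows "tends (\<lambda>k. f k \<otimes> g k) (x \<otimes> y)"
proof (rule tendsI_le)
  fix k
  have c: "f k \<in> carrier A" "g k \<in> carrier A" "x \<in> carrier A" "y \<in> carrier A"
    using assms by (auto simp: tends_def)
  let ?d = "f k \<ominus> x" and ?e = "g k \<ominus> y"
  have "f k \<otimes> g k \<ominus> x \<otimes> y = ?d \<otimes> g k \<oplus> x \<otimes> ?e"
    using c by (simp add: minus_eq l_distr r_distr l_minus r_minus a_assoc r_neg1 r_neg2)
  also have "nrm A \<dots> \<le> nrm A ?d * nrm A (g k) + nrm A x * nrm A ?e"
    using c by (intro order_trans[OF nrm_triangle] add_mono nrm_mult) auto
  finally show "nrm A (f k \<otimes> g k \<ominus> x \<otimes> y) \<le> nrm A ?d * nrm A (g k) + nrm A x * nrm A ?e" .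
next
  have "(\<lambda>k. nrm A (f k \<ominus> x) * nrm A (g k) + nrm A x * nrm A (g k \<ominus> y))
      \<longlonglongrightarrow> 0 * nrm A y + nrm A x * 0"
    using assms tends_nrm[OF assms(2)] unfolding tends_def by (intro tendsto_intros) auto
  then show "(\<lambda>k. nrm A (f k \<ominus> x) * nrm A (g k) + nrm A x * nrm A (g k \<ominus> y)) \<longlonglongrightarrow> 0" by simp
qed (use assms in \<open>auto simp: tends_def\<close>)

lemma tends_minus: "tends f x \<Longrightarrow> tends (\<lambda>k. \<ominus> f k) (\<ominus> x)"
  using tends_smult[of f x "-1"] by (simp add: tends_def minus_one_smult)

lemma tends_diff: "tends f x \<Longrightarrow> tends g y \<Longrightarrow> tends (\<lambda>k. f k \<ominus> g k) (x \<ominus> y)"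
  by (simp add: minus_eq tends_add tends_minus)

lemma tends_unique: "tends f x \<Longrightarrow> tends f y \<Longrightarrow> x = y"
proof -
  assume t: "tends f x" "tends f y"
  then have c: "x \<in> carrier A" "y \<in> carrier A" "f k \<in> carrier A" for k by (auto simp: tends_def)
  have "tends (\<lambda>k. f k \<ominus> f k) (x \<ominus> y)" by (rule tends_diff[OF t])
  moreover have "f k \<ominus> f k = \<zero>" for k using c by (simp add: r_neg minus_eq)
  ultimately have "(\<lambda>k. 0) \<longlonglongrightarrow> nrm A (x \<ominus> y)" using tends_nrm[of "\<lambda>k. f k \<ominus> f k" "x \<ominus> y"] by simp
  then have "nrm A (x \<ominus> y) = 0" using LIMSEQ_unique tendsto_const by blast
  then show "x = y" using c nrm_eq_zero[of "x \<ominus> y"] by simp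
qed

lemma tends_shift: "tends f x \<Longrightarrow> tends (\<lambda>k. f (Suc k)) x"
  using LIMSEQ_Suc unfolding tends_def by fastforce

lemma tends_nrm_less:
  assumes "tends f x" "\<epsilon> > 0"
  shows "\<exists>i. nrm A (f i \<ominus> x) < \<epsilon>"
proof -
  have "(\<lambda>k. nrm A (f k \<ominus> x)) \<longlonglongrightarrow> 0" using assms by (simp add: tends_def)
  from LIMSEQ_D[OF this assms(2)] obtain i where "norm (nrm A (f i \<ominus> x) - 0) < \<epsilon>" by blast
  then show ?thesis by (intro exI[of _ i]) simp
qed

lemma tends_eventually_const:
  assumes c: "c \<in> carrier A" "\<And>k. f k \<in> carrier A" "\<And>k. k \<ge> N \<Longrightarrow> f k = c"
  shows "tends f c"
  unfolding tends_def
proof (intro conjI allI)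
  have "eventually (\<lambda>k. nrm A (f k \<ominus> c) = 0) sequentially"
    using eventually_ge_at_top[of N] by eventually_elim (use c in \<open>simp add: minus_eq r_neg\<close>)
  then show "(\<lambda>k. nrm A (f k \<ominus> c)) \<longlonglongrightarrow> 0" by (rule tendsto_eventually)
qed (use c in auto)

text \<open>The norm topology is metric, so through this link closures and closed sets can be tested
  on sequences.\<close>

lemma tends_iff_limitin:
  "tends f x \<longleftrightarrow> (\<forall>k. f k \<in> carrier A) \<and> limitin (norm_topology A) f x sequentially"
proof -
  interpret M: Metric_space "carrier A" "cstar_dist A" by (rule Metric_space_cstar)
  show ?thesis
    unfolding norm_topology_def M.limit_metric_sequentially tends_def LIMSEQ_iff
    by (auto simp: cstar_dist_def nrm_nonneg)
qed

lemma Cauchy_tends: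
  assumes "\<And>k. f k \<in> carrier A"
    and "\<And>\<epsilon>. \<epsilon> > 0 \<Longrightarrow> \<exists>N. \<forall>i\<ge>N. \<forall>j\<ge>N. nrm A (f i \<ominus> f j) < \<epsilon>"
  shows "\<exists>x. tends f x"
proof -
  interpret M: Metric_space "carrier A" "cstar_dist A" by (rule Metric_space_cstar)
  have "M.MCauchy f" unfolding M.MCauchy_def
  proof (intro conjI allI impI)
    fix e :: real assume "e > 0"
    then show "\<exists>N. \<forall>n n'. N \<le> n \<longrightarrow> N \<le> n' \<longrightarrow> cstar_dist A (f n) (f n') < e"
      using assms(2)[of e] assms(1) by (auto simp: cstar_dist_def)
  qed (use assms in auto)
  then obtain x where "limitin M.mtopology f x sequentially"
    using nrm_complete unfolding M.mcomplete_def by blast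
  then show ?thesis using tends_iff_limitin assms by (auto simp: norm_topology_def)
qed

lemma mem_closure_iff_tends:
  assumes "U \<subseteq> carrier A"
  shows "x \<in> norm_topology A closure_of U \<longleftrightarrow> (\<exists>f. (\<forall>k. f k \<in> U) \<and> tends f x)"
proof -
  interpret M: Metric_space "carrier A" "cstar_dist A" by (rule Metric_space_cstar)
  have "x \<in> norm_topology A closure_of U \<longleftrightarrow>
      (\<exists>f. range f \<subseteq> U \<inter> carrier A \<and> limitin (norm_topology A) f x sequentially)"
    unfolding norm_topology_def M.closure_of_sequentially using M.limitin_mspace by blast
  also have "\<dots> \<longleftrightarrow> (\<exists>f. (\<forall>k. f k \<in> U) \<and> tends f x)"
    unfolding tends_iff_limitin using assms by (intro ex_cong1) blast
  finally show ?thesis .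
qed

lemma closedin_norm_topology_iff:
  "closedin (norm_topology A) U \<longleftrightarrow>
     U \<subseteq> carrier A \<and> (\<forall>f x. (\<forall>k. f k \<in> U) \<longrightarrow> tends f x \<longrightarrow> x \<in> U)"
proof -
  interpret M: Metric_space "carrier A" "cstar_dist A" by (rule Metric_space_cstar)
  have "closedin (norm_topology A) U \<longleftrightarrow> U \<subseteq> carrier A \<and>
      (\<forall>f x. range f \<subseteq> U \<and> limitin (norm_topology A) f x sequentially \<longrightarrow> x \<in> U)"
    unfolding norm_topology_def M.metric_closedin_iff_sequentially_closed by (rule refl)
  then show ?thesis unfolding tends_iff_limitin by (simp add: image_subset_iff) blast
qed

section \<open>Star-subalgebras and density\<close>

definition star_subalgebra :: "'a set \<Rightarrow> bool" where
  "star_subalgebra U \<longleftrightarrow> U \<subseteq> carrier A \<and> \<one> \<in> U \<and> (\<forall>x\<in>U. \<forall>y\<in>U. x \<oplus> y \<in> U \<and> x \<otimes> y \<in> U)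
     \<and> (\<forall>c. \<forall>x\<in>U. c \<odot> x \<in> U) \<and> (\<forall>x\<in>U. adj A x \<in> U)"

lemma star_subalgebra_minus: "star_subalgebra U \<Longrightarrow> x \<in> U \<Longrightarrow> \<ominus> x \<in> U"
  using minus_one_smult[of x] unfolding star_subalgebra_def by (metis subsetD)

lemma cstar_subalgebra_iff:
  "cstar_subalgebra U A \<longleftrightarrow> star_subalgebra U \<and> closedin (norm_topology A) U"
proof
  assume c: "cstar_subalgebra U A"
  then have "subring U A" by (simp add: cstar_subalgebra_def)
  from subringE(1,3,6,7)[OF this] c show "star_subalgebra U \<and> closedin (norm_topology A) U"
    by (simp add: cstar_subalgebra_def star_subalgebra_def)
next
  assume a: "star_subalgebra U \<and> closedin (norm_topology A) U"
  then have "subring U A"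
    using star_subalgebra_minus[of U] by (intro subringI) (simp_all add: star_subalgebra_def)
  then show "cstar_subalgebra U A" using a by (auto simp: cstar_subalgebra_def star_subalgebra_def)
qed

lemma cstar_subalgebra_closure:
  assumes U: "star_subalgebra U"
  shows "cstar_subalgebra (norm_topology A closure_of U) A"
proof -
  let ?C = "norm_topology A closure_of U"
  have sub: "U \<subseteq> carrier A" using U by (simp add: star_subalgebra_def)
  note mem = mem_closure_iff_tends[OF sub]
  have "star_subalgebra ?C"
    unfolding star_subalgebra_def
  proof (intro conjI allI ballI)
    show "?C \<subseteq> carrier A" using mem by (auto simp: tends_def)
    show "\<one> \<in> ?C" unfolding mem
      using U tends_const by (intro exI[of _ "\<lambda>k. \<one>"]) (auto simp: star_subalgebra_def)
    fix x assume "x \<in> ?C"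
    then obtain f where f: "\<forall>k. f k \<in> U" "tends f x" using mem by blast
    show "c \<odot> x \<in> ?C" for c unfolding mem
      using U f tends_smult by (intro exI[of _ "\<lambda>k. c \<odot> f k"]) (auto simp: star_subalgebra_def)
    show "adj A x \<in> ?C" unfolding mem
      using U f tends_adj by (intro exI[of _ "\<lambda>k. adj A (f k)"]) (auto simp: star_subalgebra_def)
    fix y assume "y \<in> ?C"
    then obtain g where g: "\<forall>k. g k \<in> U" "tends g y" using mem by blast
    show "x \<oplus> y \<in> ?C" unfolding mem
      using U f g tends_add by (intro exI[of _ "\<lambda>k. f k \<oplus> g k"]) (auto simp: star_subalgebra_def)
    show "x \<otimes> y \<in> ?C" unfolding mem
      using U f g tends_mult by (intro exI[of _ "\<lambda>k. f k \<otimes> g k"]) (auto simp: star_subalgebra_def)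
  qed
  then show ?thesis by (simp add: cstar_subalgebra_iff)
qed

text \<open>The closure of a star-subalgebra containing \<open>X\<close> is one of the
  C*-subalgebras in the defining intersection. This is the source of density for sets such as
  \<open>banded\<close>.\<close>

lemma cstar_generated_subset_closure:
  assumes U: "star_subalgebra U" and X: "X \<subseteq> U"
  shows "cstar_generated A X \<subseteq> norm_topology A closure_of U"
proof -
  have "U \<subseteq> norm_topology A closure_of U"
    using U Metric_space.topspace_mtopology[OF Metric_space_cstar]
    by (intro closure_of_subset) (simp add: star_subalgebra_def norm_topology_def)
  then show ?thesis
    using cstar_subalgebra_closure[OF U] X unfolding cstar_generated_def by blast
qed

end

section \<open>Square roots and contractivity of homomorphisms\<close>

lemma star_homD:
  assumes "h \<in> star_hom A B"
  shows "x \<in> carrier A \<Longrightarrow> h x \<in> carrier B"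
    and "\<lbrakk>x \<in> carrier A; y \<in> carrier A\<rbrakk> \<Longrightarrow> h (x \<otimes>\<^bsub>A\<^esub> y) = h x \<otimes>\<^bsub>B\<^esub> h y"
    and "\<lbrakk>x \<in> carrier A; y \<in> carrier A\<rbrakk> \<Longrightarrow> h (x \<oplus>\<^bsub>A\<^esub> y) = h x \<oplus>\<^bsub>B\<^esub> h y"
    and "h \<one>\<^bsub>A\<^esub> = \<one>\<^bsub>B\<^esub>"
    and "x \<in> carrier A \<Longrightarrow> h (c \<odot>\<^bsub>A\<^esub> x) = c \<odot>\<^bsub>B\<^esub> h x"
    and "x \<in> carrier A \<Longrightarrow> h (adj A x) = adj B (h x)"
  using assms
  by (auto simp: star_hom_def ring_hom_closed ring_hom_mult ring_hom_add ring_hom_one)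

lemma star_homI:
  assumes "\<And>x. x \<in> carrier A \<Longrightarrow> h x \<in> carrier B"
    and "\<And>x y. \<lbrakk>x \<in> carrier A; y \<in> carrier A\<rbrakk> \<Longrightarrow> h (x \<otimes>\<^bsub>A\<^esub> y) = h x \<otimes>\<^bsub>B\<^esub> h y"
    and "\<And>x y. \<lbrakk>x \<in> carrier A; y \<in> carrier A\<rbrakk> \<Longrightarrow> h (x \<oplus>\<^bsub>A\<^esub> y) = h x \<oplus>\<^bsub>B\<^esub> h y"
    and "h \<one>\<^bsub>A\<^esub> = \<one>\<^bsub>B\<^esub>"
    and "\<And>c x. x \<in> carrier A \<Longrightarrow> h (c \<odot>\<^bsub>A\<^esub> x) = c \<odot>\<^bsub>B\<^esub> h x"
    and "\<And>x. x \<in> carrier A \<Longrightarrow> h (adj A x) = adj B (h x)"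
  shows "h \<in> star_hom A B"
  using assms by (auto simp: star_hom_def intro!: ring_hom_memI)

context unital_cstar_algebra
begin

text \<open>Writing \<open>b\<^sup>2 + y\<^sup>2 = u\<^sup>* u\<close> with \<open>u = b + iy\<close> and \<open>b = (u + u\<^sup>*) / 2\<close> replaces any appeal to
  positivity or spectral theory.\<close>

lemma nrm_le_of_sum_squares:
  assumes c: "b \<in> carrier A" "y \<in> carrier A" and sa: "adj A b = b" "adj A y = y"
    and comm: "b \<otimes> y = y \<otimes> b" and sq: "b \<otimes> b \<oplus> y \<otimes> y = complex_of_real r \<odot> \<one>"
  shows "(nrm A b)\<^sup>2 \<le> \<bar>r\<bar>"
proof -
  define u where "u = b \<oplus> \<i> \<odot> y"
  have u: "u \<in> carrier A" using c by (simp add: u_def)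
  have au: "adj A u = b \<oplus> (-\<i>) \<odot> y" using c sa by (simp add: u_def adj_add adj_smult)
  have iy: "\<i> \<odot> y \<in> carrier A" "(-\<i>) \<odot> y \<in> carrier A" using c by auto
  define q where "q = b \<otimes> y"
  have q: "q \<in> carrier A" using c by (simp add: q_def)
  have "adj A u \<otimes> u = b \<otimes> b \<oplus> \<i> \<odot> q \<oplus> ((-\<i>) \<odot> q \<oplus> ((-\<i>) * \<i>) \<odot> (y \<otimes> y))"
    unfolding au unfolding u_def
    using c iy smult_assoc1[of "-\<i>" "\<i>" "y \<otimes> y"] smult_assoc1[of "\<i>" "-\<i>" "y \<otimes> y"]
    by (simp add: l_distr r_distr smult_mult_left smult_mult_right q_def comm smult_r_distr a_ac)
  also have "\<dots> = b \<otimes> b \<oplus> (\<i> \<odot> q \<oplus> (-\<i>) \<odot> q) \<oplus> y \<otimes> y"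
    using c q smult_one[of "y \<otimes> y"] by (simp add: a_assoc)
  also have "\<i> \<odot> q \<oplus> (-\<i>) \<odot> q = \<zero>"
    using smult_l_distr[of "\<i>" "-\<i>" q] q smult_l_null[OF q] by simp
  finally have "adj A u \<otimes> u = complex_of_real r \<odot> \<one>" using c sq by simp
  then have nu: "(nrm A u)\<^sup>2 = \<bar>r\<bar>" using cstar_identity[OF u] nrm_smult[of \<one> "complex_of_real r"] by simp
  have "u \<oplus> adj A u = b \<oplus> b \<oplus> (\<i> \<odot> y \<oplus> (-\<i>) \<odot> y)"
    unfolding au unfolding u_def using c iy by (simp add: a_ac)
  also have "\<i> \<odot> y \<oplus> (-\<i>) \<odot> y = \<zero>"
    using smult_l_distr[of "\<i>" "-\<i>" y] c smult_l_null[OF c(2)] by simp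
  finally have "u \<oplus> adj A u = 2 \<odot> b"
    using c smult_l_distr[of 1 1 b] smult_one[of b] by simp
  then have "2 * nrm A b \<le> nrm A u + nrm A u"
    using nrm_triangle[of u "adj A u"] u c nrm_smult[of b 2] by (simp add: adj_closed)
  then have "nrm A b \<le> nrm A u" by simp
  then show ?thesis using nu nrm_nonneg[OF c(1)] by (metis power_mono)
qed

lemma half_double: "x \<in> carrier A \<Longrightarrow> (1/2) \<odot> x \<oplus> (1/2) \<odot> x = x"
  using smult_l_distr[of "1/2" "1/2" x] smult_one[of x] by simp

text \<open>The fixed point \<open>t\<close> of the contraction \<open>t \<mapsto> (a + t\<^sup>2) / 2\<close> gives \<open>y = 1 - t\<close>.\<close>

lemma selfadjoint_sqrt_one_minus:
  assumes a: "a \<in> carrier A" "adj A a = a" "nrm A a < 1"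
  obtains y where "y \<in> carrier A" "adj A y = y" "y \<otimes> y = \<one> \<ominus> a"
    "\<forall>x\<in>carrier A. a \<otimes> x = x \<otimes> a \<longrightarrow> y \<otimes> x = x \<otimes> y"
proof -
  \<comment> \<open>\<open>r\<close> is the smaller root of \<open>2 * r = nrm A a + r * r\<close>,
    so the iteration stays in the ball of radius \<open>r\<close> about 0 and contracts there by the
    factor \<open>r < 1\<close>.\<close>
  define r where "r = 1 - sqrt (1 - nrm A a)"
  have s: "(sqrt (1 - nrm A a))\<^sup>2 = 1 - nrm A a" "sqrt (1 - nrm A a) > 0" "sqrt (1 - nrm A a) \<le> 1"
    using a nrm_nonneg[of a] by auto
  have r: "0 \<le> r" "r < 1" "nrm A a + r * r = 2 * r"
    using s by (auto simp: r_def power2_eq_square algebra_simps)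
  define G where "G t = (1/2) \<odot> (a \<oplus> t \<otimes> t)" for t
  define t where "t k = (G ^^ k) \<zero>" for k
  have t0: "t 0 = \<zero>" and tS: "t (Suc k) = G (t k)" for k by (auto simp: t_def)
  have tc: "t k \<in> carrier A" for k by (induction k) (use a in \<open>auto simp: t0 tS G_def\<close>)
  have tsa: "adj A (t k) = t k" for k
    by (induction k) (use a tc in \<open>auto simp: t0 tS G_def adj_smult adj_add adj_mult\<close>)
  have tcomm: "t k \<otimes> x = x \<otimes> t k" if x: "x \<in> carrier A" "a \<otimes> x = x \<otimes> a" for k x
  proof (induction k)
    case (Suc k)
    have "t k \<otimes> t k \<otimes> x = x \<otimes> (t k \<otimes> t k)"
      using Suc tc x by (metis m_assoc)
    then show ?case using a x tc
      by (simp add: tS G_def smult_mult_left smult_mult_right l_distr r_distr)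
  qed (use x in \<open>simp add: t0\<close>)
  have tr: "nrm A (t k) \<le> r" for k
  proof (induction k)
    case (Suc k)
    have "nrm A (a \<oplus> t k \<otimes> t k) \<le> nrm A a + nrm A (t k \<otimes> t k)"
      using a tc by (intro nrm_triangle) auto
    also have "\<dots> \<le> nrm A a + nrm A (t k) * nrm A (t k)"
      using nrm_mult[OF tc tc] by simp
    also have "\<dots> \<le> nrm A a + r * r"
      using Suc nrm_nonneg[OF tc] r by (intro add_left_mono mult_mono) auto
    finally show ?case using a tc r by (simp add: tS G_def nrm_smult)
  qed (use r in \<open>simp add: t0\<close>)
  have step: "nrm A (t (Suc i) \<ominus> t (Suc j)) \<le> r * nrm A (t i \<ominus> t j)" for i j
  proof -
    have "t (Suc i) \<ominus> t (Suc j) = (1/2) \<odot> ((a \<oplus> t i \<otimes> t i) \<ominus> (a \<oplus> t j \<otimes> t j))"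
      using a tc by (simp add: tS G_def minus_eq smult_r_distr smult_r_minus)
    also have "(a \<oplus> t i \<otimes> t i) \<ominus> (a \<oplus> t j \<otimes> t j) = t i \<otimes> t i \<ominus> t j \<otimes> t j"
      using a tc by algebra
    also have "\<dots> = (t i \<ominus> t j) \<otimes> t i \<oplus> t j \<otimes> (t i \<ominus> t j)"
      using tc by (simp add: minus_eq l_distr r_distr l_minus r_minus a_assoc r_neg1 r_neg2)
    finally have "nrm A (t (Suc i) \<ominus> t (Suc j))
        = 1/2 * nrm A ((t i \<ominus> t j) \<otimes> t i \<oplus> t j \<otimes> (t i \<ominus> t j))"
      using tc by (simp add: nrm_smult)
    also have "nrm A ((t i \<ominus> t j) \<otimes> t i \<oplus> t j \<otimes> (t i \<ominus> t j))
        \<le> nrm A (t i \<ominus> t j) * nrm A (t i) + nrm A (t j) * nrm A (t i \<ominus> t j)"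
      using tc by (intro order_trans[OF nrm_triangle] add_mono nrm_mult) auto
    also have "\<dots> \<le> nrm A (t i \<ominus> t j) * r + r * nrm A (t i \<ominus> t j)"
      using tc tr nrm_nonneg by (intro add_mono mult_left_mono mult_right_mono) auto
    finally show ?thesis by simp
  qed
  \<comment> \<open>Since \<open>t 0\<close> is zero, comparing \<open>t (m + i)\<close> with
    \<open>t i\<close> comes down, after \<open>i\<close> contractions, to the bound on
    \<open>t m\<close>.\<close>
  have geo: "nrm A (t (m + i) \<ominus> t i) \<le> r ^ i * r" for m i
  proof (induction i)
    case (Suc i)
    have "nrm A (t (m + Suc i) \<ominus> t (Suc i)) \<le> r * nrm A (t (m + i) \<ominus> t i)"
      using step[of "m + i" i] by simp
    also have "\<dots> \<le> r * (r ^ i * r)" using Suc r by (intro mult_left_mono) auto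
    finally show ?case by simp
  qed (use tr tc in \<open>simp add: t0 minus_eq\<close>)
  have "\<exists>l. tends t l"
  proof (rule Cauchy_tends)
    fix \<epsilon> :: real assume "\<epsilon> > 0"
    have "(\<lambda>i. r ^ i * r) \<longlonglongrightarrow> 0" using r by (intro tendsto_mult_left_zero LIMSEQ_power_zero) simp
    then obtain N where N: "\<And>i. i \<ge> N \<Longrightarrow> norm (r ^ i * r - 0) < \<epsilon>"
      using \<open>\<epsilon> > 0\<close> LIMSEQ_iff[of "\<lambda>i. r ^ i * r" 0] by blast
    have *: "nrm A (t j \<ominus> t i) < \<epsilon>" if "i \<ge> N" "j \<ge> i" for i j
      using geo[of "j - i" i] N[of i] that r by simp
    show "\<exists>N. \<forall>i\<ge>N. \<forall>j\<ge>N. nrm A (t i \<ominus> t j) < \<epsilon>"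
    proof (intro exI[of _ N] allI impI)
      fix i j assume "N \<le> i" "N \<le> j"
      then show "nrm A (t i \<ominus> t j) < \<epsilon>"
        using *[of i j] *[of j i] nrm_diff_commute[OF tc tc, of i j] by (cases "i \<le> j") auto
    qed
  qed (rule tc)
  then obtain l where l: "tends t l" ..
  then have lc: "l \<in> carrier A" by (simp add: tends_def)
  have "tends (\<lambda>k. G (t k)) (G l)"
    unfolding G_def using a l by (intro tends_smult tends_add tends_mult tends_const)
  then have fix_l: "G l = l"
    by (rule tends_unique) (rule tends_shift[OF l, unfolded tS])
  have "G l \<oplus> G l = a \<oplus> l \<otimes> l"
    using half_double[of "a \<oplus> l \<otimes> l"] a lc by (simp add: G_def)
  then have sum_l: "l \<oplus> l = a \<oplus> l \<otimes> l" unfolding fix_l .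
  show thesis
  proof
    show "\<one> \<ominus> l \<in> carrier A" using lc by simp
    have "adj A l = l" by (rule tends_unique[OF tends_adj[OF l, unfolded tsa] l])
    then show "adj A (\<one> \<ominus> l) = \<one> \<ominus> l" using lc by (simp add: adj_diff)
    have "(\<one> \<ominus> l) \<otimes> (\<one> \<ominus> l) = \<one> \<ominus> (l \<oplus> l) \<oplus> l \<otimes> l"
      using lc by (simp add: minus_eq l_distr r_distr l_minus r_minus minus_add a_ac)
    also have "\<dots> = \<one> \<ominus> a" unfolding sum_l using lc a by algebra
    finally show "(\<one> \<ominus> l) \<otimes> (\<one> \<ominus> l) = \<one> \<ominus> a" .
    show "\<forall>x\<in>carrier A. a \<otimes> x = x \<otimes> a \<longrightarrow> (\<one> \<ominus> l) \<otimes> x = x \<otimes> (\<one> \<ominus> l)"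
    proof (intro ballI impI)
      fix x assume x: "x \<in> carrier A" "a \<otimes> x = x \<otimes> a"
      have "tends (\<lambda>k. t k \<otimes> x) (l \<otimes> x)" "tends (\<lambda>k. x \<otimes> t k) (x \<otimes> l)"
        using l x by (auto intro!: tends_mult tends_const)
      then have "l \<otimes> x = x \<otimes> l" unfolding tcomm[OF x] by (rule tends_unique)
      then show "(\<one> \<ominus> l) \<otimes> x = x \<otimes> (\<one> \<ominus> l)"
        using lc x by (simp add: minus_eq l_distr r_distr l_minus r_minus)
    qed
  qed
qed

text \<open>For self-adjoint \<open>x\<close> of norm below 1 a square root \<open>y\<close> of 1 -
  x^2 gives h(x)^2 + h(y)^2 = 1 with commuting self-adjoint terms, so
  \<open>nrm_le_of_sum_squares\<close> bounds h(x) by 1. Scaling gives the self-adjoint case and the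
  C*-identity the general one.\<close>

lemma star_hom_contractive:
  assumes B: "unital_cstar_algebra B" and h: "h \<in> star_hom A B" and x: "x \<in> carrier A"
  shows "nrm B (h x) \<le> nrm A x"
proof -
  interpret B: unital_cstar_algebra B by (rule B)
  note hD = star_homD[OF h]
  have one: "nrm B (h x) \<le> 1" if x: "x \<in> carrier A" "adj A x = x" "nrm A x < 1" for x
  proof -
    have sq: "nrm A (x \<otimes> x) < 1"
      using cstar_identity[OF x(1)] x nrm_nonneg[OF x(1)] by (simp add: power_less_one_iff)
    have xx: "x \<otimes> x \<in> carrier A" "adj A (x \<otimes> x) = x \<otimes> x" using x by (auto simp: adj_mult)
    obtain y where y: "y \<in> carrier A" "adj A y = y" "y \<otimes> y = \<one> \<ominus> x \<otimes> x"
      "\<forall>z\<in>carrier A. x \<otimes> x \<otimes> z = z \<otimes> (x \<otimes> x) \<longrightarrow> y \<otimes> z = z \<otimes> y"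
      by (rule selfadjoint_sqrt_one_minus[OF xx sq])
    have yx: "y \<otimes> x = x \<otimes> y" using y(4) x m_assoc[of x x x] by blast
    have "x \<otimes> x \<oplus> y \<otimes> y = \<one>" unfolding y(3) using x by algebra
    then have "h (x \<otimes> x \<oplus> y \<otimes> y) = \<one>\<^bsub>B\<^esub>" by (simp only: hD(4))
    then have "h x \<otimes>\<^bsub>B\<^esub> h x \<oplus>\<^bsub>B\<^esub> h y \<otimes>\<^bsub>B\<^esub> h y = \<one>\<^bsub>B\<^esub>"
      using x y(1) by (simp add: hD(2,3))
    then have "h x \<otimes>\<^bsub>B\<^esub> h x \<oplus>\<^bsub>B\<^esub> h y \<otimes>\<^bsub>B\<^esub> h y = complex_of_real 1 \<odot>\<^bsub>B\<^esub> \<one>\<^bsub>B\<^esub>"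
      by simp
    moreover have "h x \<otimes>\<^bsub>B\<^esub> h y = h y \<otimes>\<^bsub>B\<^esub> h x"
      using yx hD(2)[of x y] hD(2)[of y x] x y(1) by simp
    ultimately have "(nrm B (h x))\<^sup>2 \<le> \<bar>1\<bar>"
      using x y(1,2) hD(1,6)[of x] hD(1,6)[of y] by (intro B.nrm_le_of_sum_squares[of _ "h y"]) auto
    then show ?thesis using power2_le_imp_le[of "nrm B (h x)" 1] by simp
  qed
  have sa: "nrm B (h x) \<le> nrm A x" if x: "x \<in> carrier A" "adj A x = x" for x
  proof (rule dense_ge)
    fix s assume s: "nrm A x < s"
    then have "s > 0" using nrm_nonneg[OF x(1)] by simp
    have "nrm B (h (complex_of_real (1/s) \<odot> x)) \<le> 1"
      using x s \<open>s > 0\<close> by (intro one) (auto simp: adj_smult nrm_smult norm_divide)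
    then show "nrm B (h x) \<le> s"
      using x hD(1,5)[of x] \<open>s > 0\<close> by (simp add: B.nrm_smult norm_divide)
  qed
  have "(nrm B (h x))\<^sup>2 = nrm B (h (adj A x \<otimes> x))"
    using x hD(1,6)[of x] hD(2)[of "adj A x" x] by (simp add: B.cstar_identity adj_closed)
  also have "\<dots> \<le> nrm A (adj A x \<otimes> x)"
    using x by (intro sa) (auto simp: adj_mult adj_closed adj_adj)
  also have "\<dots> = (nrm A x)\<^sup>2" using x by (simp add: cstar_identity)
  finally show ?thesis using nrm_nonneg[OF x] by (rule power2_le_imp_le)
qed

section \<open>Continuity of homomorphisms and its consequences\<close>

lemma star_hom_tends:
  assumes "h \<in> star_hom A A" "tends f x"
  shows "tends (\<lambda>k. h (f k)) (h x)"
proof (rule tendsI_le)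
  note hD = star_homD[OF assms(1)]
  have c: "x \<in> carrier A" "f k \<in> carrier A" for k using assms(2) by (auto simp: tends_def)
  show "h x \<in> carrier A" "h (f k) \<in> carrier A" for k using c hD(1) by auto
  have hm: "h (f k \<ominus> x) = h (f k) \<ominus> h x" for k
    using c hD(3)[of "f k" "(-1) \<odot> x"] hD(5)[of x "-1"] hD(1)[of x]
    by (simp add: minus_one_smult minus_eq)
  show "nrm A (h (f k) \<ominus> h x) \<le> nrm A (f k \<ominus> x)" for k
    using star_hom_contractive[OF unital_cstar_algebra_axioms assms(1), of "f k \<ominus> x"] c by (simp add: hm)
  show "(\<lambda>k. nrm A (f k \<ominus> x)) \<longlonglongrightarrow> 0" using assms(2) by (simp add: tends_def)
qed

lemma star_hom_finsum:
  assumes "h \<in> star_hom A A" "finite I" "f \<in> I \<rightarrow> carrier A"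
  shows "h (\<Oplus>i\<in>I. f i) = (\<Oplus>i\<in>I. h (f i))"
  using assms(2,3)
proof (induction I rule: finite_induct)
  note hD = star_homD[OF assms(1)]
  case empty
  show ?case using hD(5)[of \<zero> 0] hD(1)[of \<zero>] by simp
next
  note hD = star_homD[OF assms(1)]
  case (insert i I)
  then have "f i \<in> carrier A" "(\<Oplus>i\<in>I. f i) \<in> carrier A" "(\<lambda>i. h (f i)) \<in> I \<rightarrow> carrier A"
    using hD(1) by (auto intro!: finsum_closed)
  then show ?case using insert hD(1,3) by simp
qed

text \<open>The set where two homomorphisms agree is a star-subalgebra, closed because homomorphisms
  are continuous, so it contains everything generated by \<open>X\<close>.\<close>

lemma star_hom_eq_on_generated:
  assumes h: "h \<in> star_hom A A" and g: "g \<in> star_hom A A"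
    and eq: "\<And>x. x \<in> X \<Longrightarrow> h x = g x" and X: "X \<subseteq> carrier A" and x: "x \<in> cstar_generated A X"
  shows "h x = g x"
proof -
  note hD = star_homD[OF h] and gD = star_homD[OF g]
  let ?U = "{x \<in> carrier A. h x = g x}"
  have "star_subalgebra ?U"
    unfolding star_subalgebra_def using hD gD by (auto simp: adj_closed)
  moreover have "closedin (norm_topology A) ?U"
    unfolding closedin_norm_topology_iff
  proof (intro conjI allI impI)
    fix f l assume f: "\<forall>k. f k \<in> ?U" and l: "tends f l"
    have "(\<lambda>k. h (f k)) = (\<lambda>k. g (f k))" using f by auto
    then have "h l = g l"
      using tends_unique[OF star_hom_tends[OF h l]] star_hom_tends[OF g l] by simp
    then show "l \<in> ?U" using l by (simp add: tends_def)
  qed auto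
  ultimately have "cstar_subalgebra ?U A" by (simp add: cstar_subalgebra_iff)
  moreover have "X \<subseteq> ?U" using X eq by auto
  ultimately show ?thesis using x unfolding cstar_generated_def by blast
qed

text \<open>For 0 < c < 1 the element a = c (1 + k^2) has norm below 1, so 1 - a = y^2 with y
  commuting with k, and c k^2 + y^2 = 1 - c. The estimate for sums of squares gives c |k|^2 <= 1 -
  c; then c tends to 1.\<close>

lemma selfadjoint_eq_zero_of_nrm_one_plus_square:
  assumes k: "k \<in> carrier A" "adj A k = k" and n: "nrm A (\<one> \<oplus> k \<otimes> k) \<le> 1"
  shows "k = \<zero>"
proof -
  have bound: "c * (nrm A k)\<^sup>2 \<le> 1 - c" if c: "0 < c" "c < 1" for c :: real
  proof -
    define a where "a = complex_of_real c \<odot> (\<one> \<oplus> k \<otimes> k)"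
    have ac: "a \<in> carrier A" using k by (simp add: a_def)
    have "nrm A a = c * nrm A (\<one> \<oplus> k \<otimes> k)" using k c by (simp add: a_def nrm_smult)
    moreover have "c * nrm A (\<one> \<oplus> k \<otimes> k) \<le> c * 1" using n c by (intro mult_left_mono) auto
    ultimately have an: "nrm A a < 1" using c by linarith
    have asa: "adj A a = a" using k by (simp add: a_def adj_smult adj_add adj_mult)
    obtain y where y: "y \<in> carrier A" "adj A y = y" "y \<otimes> y = \<one> \<ominus> a"
      "\<forall>z\<in>carrier A. a \<otimes> z = z \<otimes> a \<longrightarrow> y \<otimes> z = z \<otimes> y"
      by (rule selfadjoint_sqrt_one_minus[OF ac asa an])
    have "a \<otimes> k = k \<otimes> a"
      using k by (simp add: a_def smult_mult_left smult_mult_right l_distr r_distr m_assoc)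
    then have yk: "y \<otimes> k = k \<otimes> y" using y(4) k by blast
    let ?s = "complex_of_real (sqrt c)"
    define b where "b = ?s \<odot> k"
    have b: "b \<in> carrier A" "adj A b = b" "b \<otimes> y = y \<otimes> b"
      using k y yk by (auto simp: b_def adj_smult smult_mult_left smult_mult_right)
    have ss: "?s * ?s = complex_of_real c" using c by (simp flip: of_real_mult)
    have bb: "b \<otimes> b = complex_of_real c \<odot> (k \<otimes> k)"
      using k smult_assoc1[of ?s ?s "k \<otimes> k"]
      by (simp add: b_def smult_mult_left smult_mult_right ss)
    have a_eq: "a = complex_of_real c \<odot> \<one> \<oplus> b \<otimes> b" using k by (simp add: a_def bb smult_r_distr)
    have "b \<otimes> b \<oplus> y \<otimes> y = \<one> \<ominus> complex_of_real c \<odot> \<one>"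
      unfolding y(3) a_eq using b by (simp add: minus_eq minus_add a_ac r_neg1 r_neg2)
    also have "\<dots> = complex_of_real (1 - c) \<odot> \<one>"
      using smult_l_distr[of 1 "- complex_of_real c" \<one>] smult_one[of \<one>]
        smult_assoc1[of "-1" "complex_of_real c" \<one>] minus_one_smult[of "complex_of_real c \<odot> \<one>"]
      by (simp add: minus_eq)
    finally have "(nrm A b)\<^sup>2 \<le> \<bar>1 - c\<bar>"
      using b y by (intro nrm_le_of_sum_squares[of b y]) auto
    moreover have "nrm A b = sqrt c * nrm A k" using k c by (simp add: b_def nrm_smult)
    ultimately show ?thesis using c by (simp add: power_mult_distrib)
  qed
  have "((\<lambda>c. c * (nrm A k)\<^sup>2 - (1 - c)) \<longlongrightarrow> 1 * (nrm A k)\<^sup>2 - (1 - 1)) (at_left (1::real))"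
    by (intro tendsto_intros)
  moreover have "eventually (\<lambda>c. c * (nrm A k)\<^sup>2 - (1 - c) \<le> 0) (at_left (1::real))"
    by (rule eventually_mono[OF eventually_at_left_real[of 0]]) (use bound in force)+
  ultimately have "1 * (nrm A k)\<^sup>2 - (1 - 1) \<le> 0"
    by (intro tendsto_upperbound[of _ _ "at_left 1"]) auto
  then show ?thesis using nrm_eq_zero k by simp
qed

text \<open>In self-adjoint directions the unit is an extreme point of the unit ball. The identity 2
  (1 + k^2) = (1 + k)^2 + (1 - k)^2 bounds the norm of 1 + k^2 by 1.\<close>

lemma selfadjoint_eq_zero_of_nrm_one_plus_minus:
  assumes k: "k \<in> carrier A" "adj A k = k"
    and n: "nrm A (\<one> \<oplus> k) \<le> 1" "nrm A (\<one> \<ominus> k) \<le> 1"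
  shows "k = \<zero>"
proof (rule selfadjoint_eq_zero_of_nrm_one_plus_square[OF k])
  have "2 \<odot> (\<one> \<oplus> k \<otimes> k) = (\<one> \<oplus> k \<otimes> k) \<oplus> (\<one> \<oplus> k \<otimes> k)"
    using smult_l_distr[of 1 1 "\<one> \<oplus> k \<otimes> k"] k by simp
  also have "\<dots> = (\<one> \<oplus> k) \<otimes> (\<one> \<oplus> k) \<oplus> (\<one> \<ominus> k) \<otimes> (\<one> \<ominus> k)"
  proof -
    have sum: "(\<one> \<oplus> q) \<oplus> (\<one> \<oplus> q) = (\<one> \<oplus> d \<oplus> q) \<oplus> (\<one> \<ominus> d \<oplus> q)"
      if "d \<in> carrier A" "q \<in> carrier A" for d q
      using that by algebra
    have "(\<one> \<oplus> k) \<otimes> (\<one> \<oplus> k) = \<one> \<oplus> (k \<oplus> k) \<oplus> k \<otimes> k"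
      using k by (simp add: l_distr r_distr a_ac)
    moreover have "(\<one> \<ominus> k) \<otimes> (\<one> \<ominus> k) = \<one> \<ominus> (k \<oplus> k) \<oplus> k \<otimes> k"
      using k by (simp add: minus_eq l_distr r_distr l_minus r_minus minus_add a_ac)
    ultimately show ?thesis using sum[of "k \<oplus> k" "k \<otimes> k"] k by simp
  qed
  finally have "2 * nrm A (\<one> \<oplus> k \<otimes> k)
      = nrm A ((\<one> \<oplus> k) \<otimes> (\<one> \<oplus> k) \<oplus> (\<one> \<ominus> k) \<otimes> (\<one> \<ominus> k))"
    using nrm_smult[of "\<one> \<oplus> k \<otimes> k" 2] k by simp
  also have "\<dots> \<le> nrm A (\<one> \<oplus> k) * nrm A (\<one> \<oplus> k) + nrm A (\<one> \<ominus> k) * nrm A (\<one> \<ominus> k)"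
    using k by (intro order_trans[OF nrm_triangle] add_mono nrm_mult) auto
  also have "\<dots> \<le> 1 * 1 + 1 * 1"
    using k n by (intro add_mono mult_mono) (auto intro: nrm_nonneg)
  finally show "nrm A (\<one> \<oplus> k \<otimes> k) \<le> 1" by simp
qed

section \<open>Finite sums and complex spans\<close>

lemma adj_finsum:
  "finite I \<Longrightarrow> f \<in> I \<rightarrow> carrier A \<Longrightarrow> adj A (\<Oplus>i\<in>I. f i) = (\<Oplus>i\<in>I. adj A (f i))"
  by (induction I rule: finite_induct) (auto simp: adj_add adj_closed Pi_iff)

lemma nrm_finsum_le:
  "finite I \<Longrightarrow> f \<in> I \<rightarrow> carrier A \<Longrightarrow> nrm A (\<Oplus>i\<in>I. f i) \<le> (\<Sum>i\<in>I. nrm A (f i))"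
proof (induction I rule: finite_induct)
  case (insert i I)
  then have "nrm A (f i \<oplus> (\<Oplus>i\<in>I. f i)) \<le> nrm A (f i) + nrm A (\<Oplus>i\<in>I. f i)"
    by (intro nrm_triangle) (auto simp: Pi_iff)
  then show ?case using insert by (simp add: Pi_iff)
qed simp

lemma finsum_one:
  "finite I \<Longrightarrow> (\<Oplus>i\<in>I. \<one>) = of_nat (card I) \<odot> \<one>"
proof (induction I rule: finite_induct)
  case (insert i I)
  then show ?case using smult_l_distr[of 1 "of_nat (card I)" \<one>] by (simp add: algebra_simps)
qed simp

lemma finsum_mem:
  assumes "finite I" "f \<in> I \<rightarrow> U" "U \<subseteq> carrier A" "\<zero> \<in> U"
    and "\<And>x y. x \<in> U \<Longrightarrow> y \<in> U \<Longrightarrow> x \<oplus> y \<in> U"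
  shows "(\<Oplus>i\<in>I. f i) \<in> U"
  using assms(1,2)
proof (induction I rule: finite_induct)
  case (insert i I)
  then have "f \<in> I \<rightarrow> carrier A" "f i \<in> carrier A" using assms(3) by auto
  then show ?case using insert assms(5) by auto
qed (use assms in simp)

lemma complex_span_closed: "X \<subseteq> carrier A \<Longrightarrow> complex_span A X \<subseteq> carrier A"
  by (auto simp: complex_span_def intro!: finsum_closed)

lemma complex_span_base: "X \<subseteq> carrier A \<Longrightarrow> x \<in> X \<Longrightarrow> x \<in> complex_span A X"
proof -
  assume x: "X \<subseteq> carrier A" "x \<in> X"
  then have "x = (\<Oplus>y\<in>{x}. 1 \<odot> y)"
    using smult_one by auto
  then show ?thesis using x unfolding complex_span_def
    by (intro CollectI exI[of _ "\<lambda>_. 1"] exI[of _ "{x}"]) auto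
qed

lemma complex_span_zero: "\<zero> \<in> complex_span A X"
  unfolding complex_span_def by (intro CollectI exI[of _ "\<lambda>_. 0"] exI[of _ "{}"]) auto

lemma complex_span_smult:
  assumes X: "X \<subseteq> carrier A" and "x \<in> complex_span A X"
  shows "d \<odot> x \<in> complex_span A X"
proof -
  obtain c Y where cY: "finite Y" "Y \<subseteq> X" "x = (\<Oplus>y\<in>Y. c y \<odot> y)"
    using assms by (auto simp: complex_span_def)
  have "d \<odot> x = (\<Oplus>y\<in>Y. d \<odot> (c y \<odot> y))"
    unfolding cY(3) using cY X by (intro finsum_smult_ldistr) auto
  also have "\<dots> = (\<Oplus>y\<in>Y. (d * c y) \<odot> y)"
    using cY X smult_assoc1 by (intro finsum_cong') auto
  finally show ?thesis using cY(1,2) unfolding complex_span_def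
    by (intro CollectI exI[of _ "\<lambda>y. d * c y"] exI[of _ Y]) auto
qed

lemma complex_span_add:
  assumes X: "X \<subseteq> carrier A" and "x \<in> complex_span A X" "y \<in> complex_span A X"
  shows "x \<oplus> y \<in> complex_span A X"
proof -
  obtain c Y where cY: "finite Y" "Y \<subseteq> X" "x = (\<Oplus>y\<in>Y. c y \<odot> y)"
    using assms by (auto simp: complex_span_def)
  obtain d Z where dZ: "finite Z" "Z \<subseteq> X" "y = (\<Oplus>y\<in>Z. d y \<odot> y)"
    using assms by (auto simp: complex_span_def)
  \<comment> \<open>Zero coefficients bring both linear combinations to the common index set
    \<open>Y \<union> Z\<close>.\<close>
  let ?c = "\<lambda>y. if y \<in> Y then c y else 0" and ?d = "\<lambda>y. if y \<in> Z then d y else 0"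
  have sub: "Y \<union> Z \<subseteq> carrier A" using cY dZ X by auto
  have "x = (\<Oplus>y\<in>Y \<union> Z. ?c y \<odot> y)"
    unfolding cY(3) using cY dZ sub smult_l_null
    by (intro add.finprod_mono_neutral_cong_left) auto
  moreover have "y = (\<Oplus>y\<in>Y \<union> Z. ?d y \<odot> y)"
    unfolding dZ(3) using cY dZ sub smult_l_null
    by (intro add.finprod_mono_neutral_cong_left) auto
  ultimately have "x \<oplus> y = (\<Oplus>y\<in>Y \<union> Z. ?c y \<odot> y \<oplus> ?d y \<odot> y)"
    using sub by (subst finsum_addf) auto
  also have "\<dots> = (\<Oplus>y\<in>Y \<union> Z. (?c y + ?d y) \<odot> y)"
    using sub smult_l_distr by (intro finsum_cong') auto
  finally show ?thesis using cY dZ unfolding complex_span_def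
    by (intro CollectI exI[of _ "\<lambda>y. ?c y + ?d y"] exI[of _ "Y \<union> Z"]) auto
qed

lemma complex_span_induct [consumes 2, case_names zero add smult base]:
  assumes "x \<in> complex_span A X" and X: "X \<subseteq> carrier A" and "P \<zero>"
    and add: "\<And>x y. \<lbrakk>x \<in> carrier A; y \<in> carrier A; P x; P y\<rbrakk> \<Longrightarrow> P (x \<oplus> y)"
    and smult: "\<And>c x. \<lbrakk>x \<in> carrier A; P x\<rbrakk> \<Longrightarrow> P (c \<odot> x)"
    and base: "\<And>x. x \<in> X \<Longrightarrow> P x"
  shows "P x"
proof -
  obtain c Y where cY: "finite Y" "Y \<subseteq> X" "x = (\<Oplus>y\<in>Y. c y \<odot> y)"
    using assms(1) by (auto simp: complex_span_def)
  have "(\<Oplus>y\<in>Y. c y \<odot> y) \<in> {x \<in> carrier A. P x}"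
  proof (intro finsum_mem)
    show "(\<lambda>y. c y \<odot> y) \<in> Y \<rightarrow> {x \<in> carrier A. P x}" 
    proof
      fix y assume "y \<in> Y"
      then have "y \<in> X" "y \<in> carrier A" using cY(2) X by auto
      then show "c y \<odot> y \<in> {x \<in> carrier A. P x}" using smult[OF _ base] by simp
    qed
    show "\<And>x y. \<lbrakk>x \<in> {x \<in> carrier A. P x}; y \<in> {x \<in> carrier A. P x}\<rbrakk> \<Longrightarrow> x \<oplus> y \<in> {x \<in> carrier A. P x}"
      using add by simp
  qed (use cY(1) assms(3) in auto)
  then show ?thesis using cY by simp
qed

end

section \<open>Cuntz families and the core\<close>

context cuntz_family
begin

text \<open>The elements \<open>h\<^sub>i = S\<^sub>j\<^sup>* S\<^sub>i S\<^sub>i\<^sup>* S\<^sub>j\<close> with \<open>i \<noteq> j\<close> sum to \<open>0\<close> and satisfy \<open>\<parallel>1 - h\<^sub>i\<parallel> \<le> 1\<close>, a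
  substitute for positivity. Hence a small multiple \<open>k\<close> of each of them satisfies \<open>\<parallel>1 \<plusminus> k\<parallel> \<le> 1\<close>.\<close>

lemma gen_orthogonal:
  assumes l: "l \<in> {1..n}" and j: "j \<in> {1..n}" and "l \<noteq> j"
  shows "adj A (S l) \<otimes> S j = \<zero>"
proof -
  define P where "P i = S i \<otimes> adj A (S i)" for i
  define h where "h i = adj A (S j) \<otimes> P i \<otimes> S j" for i
  have Sc: "S i \<in> carrier A" "adj A (S i) \<in> carrier A" if "i \<in> {1..n}" for i
    using gen_closed[OF that] adj_closed by auto
  have Pc: "P i \<in> carrier A" "adj A (P i) = P i" "P i \<otimes> P i = P i" if "i \<in> {1..n}" for i
  proof -
    note c = Sc[OF that]
    show "P i \<in> carrier A" "adj A (P i) = P i" using c by (auto simp: P_def adj_mult adj_adj)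
    have "P i \<otimes> P i = S i \<otimes> (adj A (S i) \<otimes> S i) \<otimes> adj A (S i)"
      using c by (simp add: P_def m_assoc)
    then show "P i \<otimes> P i = P i" using c isometry[OF that] by (simp add: P_def)
  qed
  note jc = Sc[OF j]
  have hc: "h i \<in> carrier A" "adj A (h i) = h i" if "i \<in> {1..n}" for i
    using Pc[OF that] jc by (auto simp: h_def adj_mult adj_adj m_assoc)
  have hn: "nrm A (\<one> \<ominus> h i) \<le> 1" if i: "i \<in> {1..n}" for i
  proof -
    note c = Pc[OF i]
    \<comment> \<open>\<open>\<one> \<ominus> h i\<close> is the compression by \<open>S j\<close>
      of the projection \<open>\<one> \<ominus> P i\<close>, hence has norm at most 1.\<close>
    have eq: "\<one> \<ominus> h i = adj A (S j) \<otimes> ((\<one> \<ominus> P i) \<otimes> S j)"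
      using isometry[OF j] c jc by (simp add: h_def minus_eq l_distr r_distr l_minus r_minus m_assoc)
    have "(\<one> \<ominus> P i) \<otimes> (\<one> \<ominus> P i) = \<one> \<ominus> P i"
      using c by (simp add: minus_eq l_distr r_distr l_minus r_minus r_neg1 r_neg2 l_neg r_neg)
    then have p: "nrm A (\<one> \<ominus> P i) \<le> 1"
      using c by (intro nrm_projection_le) (auto simp: adj_diff)
    have "nrm A (\<one> \<ominus> h i) \<le> nrm A (adj A (S j)) * (nrm A (\<one> \<ominus> P i) * nrm A (S j))"
      unfolding eq using c jc
      by (intro order_trans[OF nrm_mult] mult_left_mono nrm_mult) (auto intro: nrm_nonneg)
    then show ?thesis using p jc nrm_isometry[OF jc(1) isometry[OF j]] by simp
  qed
  have "(\<Oplus>i\<in>{1..n}. h i) = adj A (S j) \<otimes> (\<Oplus>i\<in>{1..n}. P i) \<otimes> S j"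
    unfolding h_def using Pc(1) jc by (simp add: finsum_rdistr finsum_ldistr Pi_iff)
  then have sum1: "(\<Oplus>i\<in>{1..n}. h i) = \<one>"
    using range_sum isometry[OF j] jc by (simp add: P_def)
  define I where "I = {1..n} - {j, l}"
  have I: "finite I" "I \<subseteq> {1..n}" "{1..n} = insert j (insert l I)" "j \<notin> insert l I" "l \<notin> I"
    using l j \<open>l \<noteq> j\<close> by (auto simp: I_def)
  have hI: "h \<in> I \<rightarrow> carrier A" using hc(1) I(2) by blast
  define s where "s = (\<Oplus>i\<in>I. h i)"
  have s: "s \<in> carrier A" unfolding s_def using hI by (rule finsum_closed)
  \<comment> \<open>Since \<open>h j\<close> already equals the total sum 1, the remaining terms
    cancel: \<open>h l\<close> is minus the sum \<open>s\<close> over the other indices.\<close>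
  have hj: "h j = \<one>"
    using isometry[OF j] jc by (simp add: h_def P_def m_assoc)
  have "\<one> = h j \<oplus> (h l \<oplus> s)"
    using sum1 I hI hc(1) l j unfolding I(3) by (simp add: s_def)
  then have hs: "h l \<oplus> s = \<zero>"
    using hc(1)[OF l] s unfolding hj by (simp add: add.l_cancel_one')
  define M where "M = card I"
  \<comment> \<open>This rewrites M + \<open>h l\<close> as a sum of M terms
    \<open>\<one> \<ominus> h i\<close>, each of norm at most 1.\<close>
  have "(\<Oplus>i\<in>I. \<one> \<ominus> h i) \<oplus> s = (\<Oplus>i\<in>I. \<one> \<ominus> h i \<oplus> h i)"
    unfolding s_def using hI by (intro finsum_addf[symmetric]) auto
  also have "\<dots> = (\<Oplus>i\<in>I. \<one>)"
    using hI by (intro finsum_cong') (auto simp: minus_eq a_assoc l_neg Pi_iff)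
  also have "\<dots> = of_nat M \<odot> \<one>" using I(1) by (simp add: finsum_one M_def)
  finally have "(\<Oplus>i\<in>I. \<one> \<ominus> h i) \<oplus> s \<oplus> h l = of_nat M \<odot> \<one> \<oplus> h l" by simp
  moreover have cI: "(\<Oplus>i\<in>I. \<one> \<ominus> h i) \<in> carrier A" using hI by (intro finsum_closed) auto
  ultimately have eqM: "(\<Oplus>i\<in>I. \<one> \<ominus> h i) = of_nat M \<odot> \<one> \<oplus> h l"
    using hs s hc(1)[OF l] by (simp add: a_assoc a_comm[of s])
  have "nrm A (\<Oplus>i\<in>I. \<one> \<ominus> h i) \<le> (\<Sum>i\<in>I. nrm A (\<one> \<ominus> h i))"
    using I hI by (intro nrm_finsum_le) auto
  also have "\<dots> \<le> of_nat M * 1"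
    unfolding M_def using I hn by (intro sum_bounded_above) auto
  finally have bM: "nrm A (of_nat M \<odot> \<one> \<oplus> h l) \<le> M" using eqM by simp
  \<comment> \<open>With N = M + 1 and k = \<open>h l\<close> / N, the element N (1 + k) is 1 + (M +
    \<open>h l\<close>) and N (1 - k) is (1 - \<open>h l\<close>) + M, both of norm at most
    N.\<close>
  define N where "N = real M + 1"
  have N: "N > 0" by (simp add: N_def)
  define k where "k = complex_of_real (1 / N) \<odot> h l"
  note hl = hc[OF l]
  have k: "k \<in> carrier A" "adj A k = k" using hl by (auto simp: k_def adj_smult)
  have Nk: "complex_of_real N \<odot> k = h l"
    using smult_assoc1[of "complex_of_real N" "complex_of_real (1/N)" "h l"] hl N
    by (simp add: k_def flip: of_real_mult)
  have NM: "complex_of_real N \<odot> \<one> = \<one> \<oplus> of_nat M \<odot> \<one>"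
    using smult_l_distr[of 1 "of_nat M" \<one>] by (simp add: N_def add.commute)
  have "N * nrm A (\<one> \<oplus> k) = nrm A (complex_of_real N \<odot> (\<one> \<oplus> k))"
    using k N by (simp add: nrm_smult)
  also have "complex_of_real N \<odot> (\<one> \<oplus> k) = \<one> \<oplus> (of_nat M \<odot> \<one> \<oplus> h l)"
    using k hl by (simp add: smult_r_distr Nk NM a_assoc)
  also have "nrm A \<dots> \<le> 1 + M" using hl bM by (intro order_trans[OF nrm_triangle]) auto
  also have "\<dots> = N * 1" by (simp add: N_def)
  finally have n1: "nrm A (\<one> \<oplus> k) \<le> 1" using N by (simp only: mult_le_cancel_left_pos)
  have "N * nrm A (\<one> \<ominus> k) = nrm A (complex_of_real N \<odot> (\<one> \<ominus> k))"
    using k N by (simp add: nrm_smult)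
  also have "complex_of_real N \<odot> (\<one> \<ominus> k) = (\<one> \<ominus> h l) \<oplus> of_nat M \<odot> \<one>"
    using k hl by (simp add: minus_eq smult_r_distr smult_r_minus Nk NM a_ac)
  also have "nrm A \<dots> \<le> 1 + M"
    using hl hn[OF l] nrm_smult[of \<one> "of_nat M"] by (intro order_trans[OF nrm_triangle]) auto
  also have "\<dots> = N * 1" by (simp add: N_def)
  finally have n2: "nrm A (\<one> \<ominus> k) \<le> 1" using N by (simp only: mult_le_cancel_left_pos)
  have "k = \<zero>" by (rule selfadjoint_eq_zero_of_nrm_one_plus_minus[OF k n1 n2])
  then have "h l = \<zero>" using Nk by simp
  \<comment> \<open>\<open>h l\<close> has the form x^* x for the product x in question, so the
    C*-identity turns its vanishing into the claim.\<close>
  moreover have "h l = adj A (adj A (S l) \<otimes> S j) \<otimes> (adj A (S l) \<otimes> S j)"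
    using jc Sc[OF l] by (simp add: h_def P_def adj_mult adj_adj m_assoc)
  ultimately have "(nrm A (adj A (S l) \<otimes> S j))\<^sup>2 = 0"
    using cstar_identity[of "adj A (S l) \<otimes> S j"] jc Sc[OF l] by simp
  then show ?thesis using nrm_eq_zero[of "adj A (S l) \<otimes> S j"] jc Sc[OF l] by simp
qed

lemma gen_star_closed [simp]:
  "i \<in> {1..n} \<Longrightarrow> S i \<in> carrier A" "i \<in> {1..n} \<Longrightarrow> adj A (S i) \<in> carrier A"
  using gen_closed adj_closed by auto

lemma adj_gen_mult_gen:
  "\<lbrakk>i \<in> {1..n}; j \<in> {1..n}\<rbrakk> \<Longrightarrow> adj A (S i) \<otimes> S j = (if i = j then \<one> else \<zero>)"
  using gen_orthogonal isometry by auto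

lemma adj_gen_mult_gen_mult:
  "\<lbrakk>i \<in> {1..n}; j \<in> {1..n}; x \<in> carrier A\<rbrakk> \<Longrightarrow>
     adj A (S i) \<otimes> (S j \<otimes> x) = (if i = j then x else \<zero>)"
  by (simp flip: m_assoc add: adj_gen_mult_gen)

section \<open>The canonical shift\<close>

definition shift :: "'a \<Rightarrow> 'a" where
  "shift x = (\<Oplus>i\<in>{1..n}. S i \<otimes> x \<otimes> adj A (S i))"

lemma shift_closed [simp]: "x \<in> carrier A \<Longrightarrow> shift x \<in> carrier A"
  unfolding shift_def by (intro finsum_closed) auto

text \<open>By orthogonality only the summand i = j survives. This intertwining relation governs all
  later index bookkeeping: a shifted element passing a generator loses one shift.\<close>

lemma shift_mult_gen:
  assumes x: "x \<in> carrier A" and j: "j \<in> {1..n}"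
  shows "shift x \<otimes> S j = S j \<otimes> x"
proof -
  have "shift x \<otimes> S j = (\<Oplus>i\<in>{1..n}. S i \<otimes> x \<otimes> adj A (S i) \<otimes> S j)"
    unfolding shift_def using x j by (intro finsum_ldistr) auto
  also have "\<dots> = (\<Oplus>i\<in>{1..n}. if j = i then S i \<otimes> x else \<zero>)"
    using x j by (intro finsum_cong') (auto simp: m_assoc adj_gen_mult_gen)
  also have "\<dots> = S j \<otimes> x" using x j by (intro add.finprod_singleton) auto
  finally show ?thesis .
qed

lemma adj_shift: "x \<in> carrier A \<Longrightarrow> adj A (shift x) = shift (adj A x)"
  unfolding shift_def
  by (subst adj_finsum) (auto intro!: finsum_cong' simp: adj_mult adj_adj adj_closed m_assoc)

lemma adj_gen_mult_shift:
  assumes x: "x \<in> carrier A" and j: "j \<in> {1..n}"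
  shows "adj A (S j) \<otimes> shift x = x \<otimes> adj A (S j)"
proof -
  have "adj A (shift (adj A x) \<otimes> S j) = adj A (S j \<otimes> adj A x)"
    using assms by (simp add: shift_mult_gen adj_closed)
  then show ?thesis using assms by (simp add: adj_mult adj_shift adj_adj adj_closed)
qed

text \<open>Multiplicativity comes from moving \<open>shift x\<close> through each
  \<open>S i\<close> in the sum for \<open>shift y\<close>.\<close>

lemma shift_mult:
  assumes x: "x \<in> carrier A" and y: "y \<in> carrier A"
  shows "shift (x \<otimes> y) = shift x \<otimes> shift y"
proof -
  have "shift x \<otimes> shift y = (\<Oplus>i\<in>{1..n}. shift x \<otimes> (S i \<otimes> y \<otimes> adj A (S i)))"
    unfolding shift_def[of y] using x y by (intro finsum_rdistr) auto
  also have "\<dots> = shift (x \<otimes> y)"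
    unfolding shift_def[of "x \<otimes> y"]
  proof (intro finsum_cong')
    fix i assume i: "i \<in> {1..n}"
    have "shift x \<otimes> (S i \<otimes> y \<otimes> adj A (S i)) = shift x \<otimes> S i \<otimes> y \<otimes> adj A (S i)"
      using x y i by (simp add: m_assoc)
    then show "shift x \<otimes> (S i \<otimes> y \<otimes> adj A (S i)) = S i \<otimes> (x \<otimes> y) \<otimes> adj A (S i)"
      using x y i by (simp add: shift_mult_gen m_assoc)
  qed (use x y in auto)
  finally show ?thesis ..
qed

lemma shift_one [simp]: "shift \<one> = \<one>"
proof -
  have "shift \<one> = (\<Oplus>i\<in>{1..n}. S i \<otimes> adj A (S i))"
    unfolding shift_def by (intro finsum_cong') auto
  then show ?thesis by (simp only: range_sum)
qed

lemma shift_minus: "x \<in> carrier A \<Longrightarrow> shift (\<ominus> x) = \<ominus> shift x"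
proof -
  assume x: "x \<in> carrier A"
  have "shift (\<ominus> x) = (\<Oplus>i\<in>{1..n}. (-1) \<odot> (S i \<otimes> x \<otimes> adj A (S i)))"
    unfolding shift_def using x by (intro finsum_cong') (auto simp: minus_one_smult l_minus r_minus)
  also have "\<dots> = (-1) \<odot> shift x"
    unfolding shift_def using x by (intro finsum_smult_ldistr[symmetric]) auto
  finally show ?thesis using x by (simp add: minus_one_smult)
qed

lemma shift_pow_closed [simp]: "x \<in> carrier A \<Longrightarrow> (shift ^^ k) x \<in> carrier A"
  by (induction k) auto

lemma shift_pow_mult:
  "\<lbrakk>x \<in> carrier A; y \<in> carrier A\<rbrakk> \<Longrightarrow> (shift ^^ k) (x \<otimes> y) = (shift ^^ k) x \<otimes> (shift ^^ k) y"
  by (induction k) (auto simp: shift_mult)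

lemma shift_pow_adj: "x \<in> carrier A \<Longrightarrow> adj A ((shift ^^ k) x) = (shift ^^ k) (adj A x)"
  by (induction k) (auto simp: adj_shift)

lemma shift_pow_one [simp]: "(shift ^^ k) \<one> = \<one>"
  by (induction k) auto

lemma shift_pow_minus: "x \<in> carrier A \<Longrightarrow> (shift ^^ k) (\<ominus> x) = \<ominus> (shift ^^ k) x"
  by (induction k) (auto simp: shift_minus)

section \<open>Words, matrix units and matrix levels\<close>

lemma gen_word_Nil [simp]: "gen_word A S [] = \<one>"
  and gen_word_Cons [simp]: "gen_word A S (i # w) = S i \<otimes> gen_word A S w"
  by (auto simp: gen_word_def)

lemma gen_word_closed [simp]: "set w \<subseteq> {1..n} \<Longrightarrow> gen_word A S w \<in> carrier A"
  by (induction w) auto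

lemma gen_word_snoc:
  "set w \<subseteq> {1..n} \<Longrightarrow> i \<in> {1..n} \<Longrightarrow> gen_word A S (w @ [i]) = gen_word A S w \<otimes> S i"
  by (induction w) (auto simp: m_assoc)

lemma adj_gen_word_mult_gen_word:
  "\<lbrakk>length v = length w; set v \<subseteq> {1..n}; set w \<subseteq> {1..n}\<rbrakk> \<Longrightarrow>
     adj A (gen_word A S v) \<otimes> gen_word A S w = (if v = w then \<one> else \<zero>)"
proof (induction v w rule: list_induct2)
  case (Cons i v j w)
  then have "adj A (gen_word A S (i # v)) \<otimes> gen_word A S (j # w)
      = adj A (gen_word A S v) \<otimes> (adj A (S i) \<otimes> (S j \<otimes> gen_word A S w))"
    by (simp add: adj_mult m_assoc adj_closed)
  then show ?case using Cons by (auto simp: adj_gen_mult_gen_mult adj_closed)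
qed simp

lemma shift_pow_mult_gen_word:
  "x \<in> carrier A \<Longrightarrow> set w \<subseteq> {1..n} \<Longrightarrow>
     (shift ^^ length w) x \<otimes> gen_word A S w = gen_word A S w \<otimes> x"
proof (induction w)
  case (Cons i w)
  have "(shift ^^ length (i # w)) x \<otimes> gen_word A S (i # w)
      = shift ((shift ^^ length w) x) \<otimes> S i \<otimes> gen_word A S w"
    using Cons.prems by (simp add: m_assoc)
  then show ?case using Cons by (simp add: shift_mult_gen m_assoc)
qed simp

lemma adj_gen_word_mult_shift_pow:
  assumes "x \<in> carrier A" "set w \<subseteq> {1..n}"
  shows "adj A (gen_word A S w) \<otimes> (shift ^^ length w) x = x \<otimes> adj A (gen_word A S w)"
proof -
  have "adj A ((shift ^^ length w) (adj A x) \<otimes> gen_word A S w) = adj A (gen_word A S w \<otimes> adj A x)"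
    using assms by (simp add: shift_pow_mult_gen_word adj_closed)
  then show ?thesis using assms by (simp add: adj_mult shift_pow_adj adj_adj adj_closed)
qed

definition matrix_units :: "nat \<Rightarrow> 'a set" where
  "matrix_units k = {gen_word A S v \<otimes> adj A (gen_word A S w) | v w.
     length v = k \<and> length w = k \<and> set v \<subseteq> {1..n} \<and> set w \<subseteq> {1..n}}"

lemma matrix_units_closed: "matrix_units k \<subseteq> carrier A"
  by (auto simp: matrix_units_def adj_closed)

lemma matrix_level_eq: "matrix_level n A S k = complex_span A (matrix_units k)"
  by (simp add: matrix_level_def matrix_units_def)

lemma matrix_level_closed: "matrix_level n A S k \<subseteq> carrier A"
  unfolding matrix_level_eq by (intro complex_span_closed matrix_units_closed)

lemmas matrix_level_add = complex_span_add[OF matrix_units_closed, folded matrix_level_eq]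
lemmas matrix_level_smult = complex_span_smult[OF matrix_units_closed, folded matrix_level_eq]
lemmas matrix_level_zero = complex_span_zero[of "matrix_units k" for k, folded matrix_level_eq]
lemmas matrix_level_base = complex_span_base[OF matrix_units_closed, folded matrix_level_eq]
lemmas matrix_level_induct [consumes 1, case_names zero add smult base] =
  complex_span_induct[OF _ matrix_units_closed, folded matrix_level_eq]

lemma matrix_unit_in_level:
  "\<lbrakk>length v = k; length w = k; set v \<subseteq> {1..n}; set w \<subseteq> {1..n}\<rbrakk> \<Longrightarrow>
     gen_word A S v \<otimes> adj A (gen_word A S w) \<in> matrix_level n A S k"
  by (rule matrix_level_base) (auto simp: matrix_units_def)

lemma matrix_level_finsum:
  "finite I \<Longrightarrow> f \<in> I \<rightarrow> matrix_level n A S k \<Longrightarrow> (\<Oplus>i\<in>I. f i) \<in> matrix_level n A S k"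
  by (rule finsum_mem) (use matrix_level_closed matrix_level_zero matrix_level_add in auto)

lemma matrix_level_adj: "x \<in> matrix_level n A S k \<Longrightarrow> adj A x \<in> matrix_level n A S k"
proof (induction rule: matrix_level_induct)
  case (base x)
  then obtain v w where "x = gen_word A S v \<otimes> adj A (gen_word A S w)"
    "length v = k" "length w = k" "set v \<subseteq> {1..n}" "set w \<subseteq> {1..n}"
    by (auto simp: matrix_units_def)
  then show ?case using matrix_unit_in_level[of w k v] by (simp add: adj_mult adj_adj adj_closed)
qed (auto simp: adj_add adj_smult matrix_level_zero matrix_level_add matrix_level_smult)

text \<open>Products of matrix units are matrix units or zero, since distinct words of equal length
  are orthogonal. The bilinear extension takes two inductions: first in the left factor with a
  matrix unit on the right, then in the right factor.\<close>

lemma matrix_level_mult: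
  assumes x: "x \<in> matrix_level n A S k" and y: "y \<in> matrix_level n A S k"
  shows "x \<otimes> y \<in> matrix_level n A S k"
proof -
  have units: "x \<otimes> y \<in> matrix_level n A S k" if xy: "x \<in> matrix_units k" "y \<in> matrix_units k" for x y
  proof -
    obtain v w where x: "x = gen_word A S v \<otimes> adj A (gen_word A S w)"
      "length v = k" "length w = k" "set v \<subseteq> {1..n}" "set w \<subseteq> {1..n}"
      using xy(1) by (auto simp: matrix_units_def)
    obtain v' w' where y: "y = gen_word A S v' \<otimes> adj A (gen_word A S w')"
      "length v' = k" "length w' = k" "set v' \<subseteq> {1..n}" "set w' \<subseteq> {1..n}"
      using xy(2) by (auto simp: matrix_units_def)
    note * = x y
    have "x \<otimes> y = gen_word A S v \<otimes> (adj A (gen_word A S w) \<otimes> gen_word A S v') \<otimes> adj A (gen_word A S w')"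
      using * by (simp add: m_assoc adj_closed)
    then show ?thesis using * matrix_unit_in_level[of v k w'] matrix_level_zero
      by (simp add: adj_gen_word_mult_gen_word adj_closed)
  qed
  have "x \<otimes> y \<in> matrix_level n A S k" if y: "y \<in> matrix_units k" for y
  proof -
    have yc: "y \<in> carrier A" using y matrix_units_closed by auto
    from x show ?thesis
      by (induction rule: matrix_level_induct)
        (use yc units[OF _ y] in \<open>auto simp: l_distr smult_mult_left
          intro: matrix_level_zero matrix_level_add matrix_level_smult\<close>)
  qed
  note * = this
  have xc: "x \<in> carrier A" using x matrix_level_closed by auto
  from y show ?thesis
    by (induction rule: matrix_level_induct)
      (use xc * in \<open>auto simp: r_distr smult_mult_right
        intro: matrix_level_zero matrix_level_add matrix_level_smult\<close>)
qed

text \<open>Inserting the range sum between the two words of a matrix unit lengthens both by the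
  same letter. In tensor terms this is the embedding of x as x tensor 1.\<close>

lemma matrix_level_Suc:
  "x \<in> matrix_level n A S k \<Longrightarrow> x \<in> matrix_level n A S (Suc k)"
proof (induction rule: matrix_level_induct)
  case (base x)
  then obtain v w where *: "x = gen_word A S v \<otimes> adj A (gen_word A S w)"
    "length v = k" "length w = k" "set v \<subseteq> {1..n}" "set w \<subseteq> {1..n}"
    by (auto simp: matrix_units_def)
  then have c: "gen_word A S v \<in> carrier A" "adj A (gen_word A S w) \<in> carrier A"
    by (auto simp: adj_closed)
  have "x = gen_word A S v \<otimes> (\<Oplus>i\<in>{1..n}. S i \<otimes> adj A (S i)) \<otimes> adj A (gen_word A S w)"
    using * c by (simp only: range_sum r_one)
  also have "\<dots> = (\<Oplus>i\<in>{1..n}. gen_word A S v \<otimes> (S i \<otimes> adj A (S i)) \<otimes> adj A (gen_word A S w))"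
    using c by (simp add: finsum_rdistr finsum_ldistr Pi_iff)
  also have "\<dots> = (\<Oplus>i\<in>{1..n}. gen_word A S (v @ [i]) \<otimes> adj A (gen_word A S (w @ [i])))"
    using * c by (intro finsum_cong') (auto simp: gen_word_snoc adj_mult m_assoc)
  also have "\<dots> \<in> matrix_level n A S (Suc k)"
    using * by (intro matrix_level_finsum) (auto intro!: matrix_unit_in_level)
  finally show ?case .
qed (auto intro: matrix_level_zero matrix_level_add matrix_level_smult)

lemma matrix_level_mono: "x \<in> matrix_level n A S k \<Longrightarrow> k \<le> l \<Longrightarrow> x \<in> matrix_level n A S l"
  by (rotate_tac, induction l rule: dec_induct) (auto intro: matrix_level_Suc)

text \<open>In tensor terms the shift sends x to 1 tensor x: both words of a matrix unit receive the
  same new first letter, summed over all letters.\<close>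

lemma matrix_level_shift:
  "x \<in> matrix_level n A S k \<Longrightarrow> shift x \<in> matrix_level n A S (Suc k)"
proof (induction rule: matrix_level_induct)
  case zero
  have "shift \<zero> = (\<Oplus>i\<in>{1..n}. \<zero>)" unfolding shift_def by (intro finsum_cong') auto
  then show ?case using matrix_level_zero by simp
next
  case (add x y)
  have "shift (x \<oplus> y) = (\<Oplus>i\<in>{1..n}. S i \<otimes> x \<otimes> adj A (S i) \<oplus> S i \<otimes> y \<otimes> adj A (S i))"
    unfolding shift_def using add(1,2) by (intro finsum_cong') (auto simp: l_distr r_distr)
  also have "\<dots> = shift x \<oplus> shift y"
    unfolding shift_def using add(1,2) by (intro finsum_addf) auto
  finally show ?case using add matrix_level_add by simp
next
  case (smult c x)
  have "shift (c \<odot> x) = c \<odot> shift x"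
    unfolding shift_def using smult(1)
    by (subst finsum_smult_ldistr) (auto intro!: finsum_cong' simp: smult_mult_left smult_mult_right)
  then show ?case using smult matrix_level_smult by simp
next
  case (base x)
  then obtain v w where *: "x = gen_word A S v \<otimes> adj A (gen_word A S w)"
    "length v = k" "length w = k" "set v \<subseteq> {1..n}" "set w \<subseteq> {1..n}"
    by (auto simp: matrix_units_def)
  have "shift x = (\<Oplus>i\<in>{1..n}. gen_word A S (i # v) \<otimes> adj A (gen_word A S (i # w)))"
    unfolding shift_def * using *(4,5) by (intro finsum_cong') (auto simp: adj_mult adj_closed m_assoc)
  also have "\<dots> \<in> matrix_level n A S (Suc k)"
    using * by (intro matrix_level_finsum Pi_I matrix_unit_in_level) auto
  finally show ?case .
qed

text \<open>In tensor terms the shifted \<open>y\<close> acts behind the first k factors. Passing a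
  word of length k it loses k shifts, and passing the adjoint of such a word it regains
  them.\<close>

lemma shift_pow_commutes_matrix_level:
  assumes y: "y \<in> carrier A"
  shows "x \<in> matrix_level n A S k \<Longrightarrow> (shift ^^ k) y \<otimes> x = x \<otimes> (shift ^^ k) y"
proof (induction rule: matrix_level_induct)
  case (base x)
  then obtain v w where *: "x = gen_word A S v \<otimes> adj A (gen_word A S w)"
    "length v = k" "length w = k" "set v \<subseteq> {1..n}" "set w \<subseteq> {1..n}"
    by (auto simp: matrix_units_def)
  have "(shift ^^ k) y \<otimes> x = (shift ^^ length v) y \<otimes> gen_word A S v \<otimes> adj A (gen_word A S w)"
    unfolding * using *(2,4,5) y by (simp add: m_assoc adj_closed)
  also have "\<dots> = gen_word A S v \<otimes> (y \<otimes> adj A (gen_word A S w))"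
    using * y by (subst shift_pow_mult_gen_word) (auto simp: m_assoc adj_closed)
  also have "\<dots> = gen_word A S v \<otimes> (adj A (gen_word A S w) \<otimes> (shift ^^ length w) y)"
    using * y by (subst adj_gen_word_mult_shift_pow) auto
  finally show ?case unfolding * using *(3,4,5) y by (simp add: m_assoc adj_closed)
qed (use y in \<open>auto simp: l_distr r_distr smult_mult_left smult_mult_right\<close>)

lemma one_in_matrix_level: "\<one> \<in> matrix_level n A S k"
  using matrix_level_mono[OF matrix_unit_in_level[of "[]" 0 "[]"], of k] by simp

section \<open>The core as closure of the union of the levels\<close>

definition core_algebra :: "'a set" where
  "core_algebra = (\<Union>k\<in>{1..}. matrix_level n A S k)"

text \<open>The union starts at level 1; level 0 lies in it because the levels increase.\<close>

lemma matrix_level_subset_core_algebra: "matrix_level n A S k \<subseteq> core_algebra"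
  using matrix_level_Suc by (force simp: core_algebra_def)

lemma core_algebra_common_level:
  assumes "x \<in> core_algebra" "y \<in> core_algebra"
  obtains k where "x \<in> matrix_level n A S k" "y \<in> matrix_level n A S k"
proof -
  obtain i j where "x \<in> matrix_level n A S i" "y \<in> matrix_level n A S j"
    using assms by (auto simp: core_algebra_def)
  then show thesis
    using matrix_level_mono[of x i "max i j"] matrix_level_mono[of y j "max i j"] that by simp
qed

lemma star_subalgebra_core_algebra: "star_subalgebra core_algebra"
proof -
  have mult: "x \<oplus> y \<in> core_algebra \<and> x \<otimes> y \<in> core_algebra"
    if xy: "x \<in> core_algebra" "y \<in> core_algebra" for x y
  proof -
    obtain k where "x \<in> matrix_level n A S k" "y \<in> matrix_level n A S k"
      using core_algebra_common_level[OF xy] .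
    then show ?thesis
      using matrix_level_add matrix_level_mult matrix_level_subset_core_algebra by blast
  qed
  show ?thesis
    unfolding star_subalgebra_def
  proof (intro conjI ballI allI)
    show "core_algebra \<subseteq> carrier A" using matrix_level_closed by (auto simp: core_algebra_def)
    show "\<one> \<in> core_algebra" using one_in_matrix_level matrix_level_subset_core_algebra by blast
    show "c \<odot> x \<in> core_algebra" if "x \<in> core_algebra" for c x
      using that matrix_level_smult by (auto simp: core_algebra_def)
    show "adj A x \<in> core_algebra" if "x \<in> core_algebra" for x
      using that matrix_level_adj by (auto simp: core_algebra_def)
  qed (use mult in auto)
qed

lemma core_select [simp]:
  "mult (core n A S) = mult A" "one (core n A S) = \<one>" "zero (core n A S) = \<zero>"
  "add (core n A S) = add A" "smult (core n A S) = smult A" "adj (core n A S) = adj A"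
  by (auto simp: core_def)

lemma carrier_core: "carrier (core n A S) = norm_topology A closure_of core_algebra"
  by (simp add: core_def core_algebra_def)

lemma cstar_subalgebra_core: "cstar_subalgebra (carrier (core n A S)) A"
  unfolding carrier_core by (rule cstar_subalgebra_closure[OF star_subalgebra_core_algebra])

lemma mem_core_iff_tends:
  "x \<in> carrier (core n A S) \<longleftrightarrow> (\<exists>f. (\<forall>k. f k \<in> core_algebra) \<and> tends f x)"
  unfolding carrier_core using star_subalgebra_core_algebra
  by (intro mem_closure_iff_tends) (simp add: star_subalgebra_def)

lemma core_algebra_subset_core: "core_algebra \<subseteq> carrier (core n A S)"
  unfolding subset_iff mem_core_iff_tends
  using star_subalgebra_core_algebra tends_const by (force simp: star_subalgebra_def)

end

section \<open>Isometries anticommuting with shifted flips\<close>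

locale cuntz_pair = cuntz_family n A S
  for n :: nat and A :: "'a cstar" (structure) and S :: "nat \<Rightarrow> 'a" +
  fixes p q :: nat
  assumes p: "p \<in> {1..n}" and q: "q \<in> {1..n}" and p_neq_q: "p \<noteq> q"
begin

text \<open>With p and q in place of 1 and 2, \<open>flip\<close> is the element e of the overview,
  \<open>flip_at k\<close> is e_k, and \<open>fixed_vec N\<close> is the N-th power of xi.\<close>

definition flip :: 'a where
  "flip = S p \<otimes> adj A (S q) \<oplus> S q \<otimes> adj A (S p)"

definition flip_at :: "nat \<Rightarrow> 'a" where
  "flip_at k = (shift ^^ k) flip"

definition fixed_vec :: "nat \<Rightarrow> 'a" where
  "fixed_vec N = (((\<otimes>) (S p \<oplus> S q)) ^^ N) \<one>"

lemma pq_closed [simp]: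
  "S p \<in> carrier A" "S q \<in> carrier A" "adj A (S p) \<in> carrier A" "adj A (S q) \<in> carrier A"
  using p q by auto

lemma pq_simps [simp]:
  "adj A (S p) \<otimes> S p = \<one>" "adj A (S q) \<otimes> S q = \<one>"
  "adj A (S p) \<otimes> S q = \<zero>" "adj A (S q) \<otimes> S p = \<zero>"
  "x \<in> carrier A \<Longrightarrow> adj A (S p) \<otimes> (S p \<otimes> x) = x"
  "x \<in> carrier A \<Longrightarrow> adj A (S q) \<otimes> (S q \<otimes> x) = x"
  "x \<in> carrier A \<Longrightarrow> adj A (S p) \<otimes> (S q \<otimes> x) = \<zero>"
  "x \<in> carrier A \<Longrightarrow> adj A (S q) \<otimes> (S p \<otimes> x) = \<zero>"
  using p q p_neq_q by (simp_all add: adj_gen_mult_gen adj_gen_mult_gen_mult)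

lemma flip_closed [simp]: "flip \<in> carrier A"
  by (simp add: flip_def)

lemma flip_at_closed [simp]: "flip_at k \<in> carrier A"
  by (simp add: flip_at_def)

lemma flip_at_Suc: "flip_at (Suc k) = shift (flip_at k)"
  by (simp add: flip_at_def)

lemma adj_flip_at [simp]: "adj A (flip_at k) = flip_at k"
  by (simp add: flip_at_def shift_pow_adj) (simp add: flip_def adj_add adj_mult adj_adj a_comm)

text \<open>For n > 2 the flip is a partial isometry but not a unitary, as it annihilates the other
  generators. The cube relation takes the place of flip^2 = 1.\<close>

lemma flip_cube: "flip \<otimes> (flip \<otimes> flip) = flip"
  by (simp add: flip_def l_distr r_distr m_assoc)

text \<open>By the cube relation the square of a shifted flip is a projection, and the C*-identity
  passes its norm bound to the flip.\<close>

lemma nrm_flip_at_le: "nrm A (flip_at k) \<le> 1"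
proof -
  let ?x = "flip_at k"
  have "?x \<otimes> (?x \<otimes> ?x) = (shift ^^ k) (flip \<otimes> (flip \<otimes> flip))"
    by (simp only: flip_at_def shift_pow_mult flip_closed m_closed)
  then have cube: "?x \<otimes> (?x \<otimes> ?x) = ?x" by (simp add: flip_cube flip_at_def)
  then have "(?x \<otimes> ?x) \<otimes> (?x \<otimes> ?x) = ?x \<otimes> ?x" by (simp add: m_assoc)
  then have "nrm A (?x \<otimes> ?x) \<le> 1"
    by (intro nrm_projection_le) (auto simp: adj_mult)
  then have "(nrm A ?x)\<^sup>2 \<le> 1" using cstar_identity[of ?x] by simp
  then show ?thesis using power2_le_imp_le[of "nrm A ?x" 1] by simp
qed

lemma fixed_vec_0 [simp]: "fixed_vec 0 = \<one>"
  and fixed_vec_Suc [simp]: "fixed_vec (Suc N) = (S p \<oplus> S q) \<otimes> fixed_vec N"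
  by (simp_all add: fixed_vec_def)

lemma fixed_vec_closed [simp]: "fixed_vec N \<in> carrier A"
  by (induction N) auto

text \<open>Multiplying \<open>fixed_vec (Suc N)\<close> on the left by the adjoint of
  \<open>S p \<oplus> S q\<close> gives twice \<open>fixed_vec N\<close>.\<close>

lemma fixed_vec_neq_zero: "fixed_vec N \<noteq> \<zero>"
proof (induction N)
  case (Suc N)
  let ?z = "fixed_vec N"
  have "(adj A (S p) \<oplus> adj A (S q)) \<otimes> fixed_vec (Suc N) = ?z \<oplus> ?z"
    by (simp add: l_distr r_distr)
  also have "\<dots> = 2 \<odot> ?z" using smult_l_distr[of 1 1 ?z] by simp
  finally have "nrm A ((adj A (S p) \<oplus> adj A (S q)) \<otimes> fixed_vec (Suc N)) = 2 * nrm A ?z"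
    using nrm_smult[of ?z 2] by simp
  then show ?case using Suc nrm_eq_zero[of ?z] by auto
qed (use one_not_zero in simp)

text \<open>The unshifted flip exchanges \<open>S p\<close> and \<open>S q\<close>, hence fixes
  their sum. A shifted flip passes one factor of the power and loses one shift.\<close>

lemma flip_at_fixed_vec: "j < N \<Longrightarrow> flip_at j \<otimes> fixed_vec N = fixed_vec N"
proof (induction j arbitrary: N)
  case 0
  then obtain M where "N = Suc M" by (cases N) auto
  then show ?case by (simp add: flip_at_def flip_def l_distr r_distr m_assoc a_comm)
next
  case (Suc j)
  then obtain M where N: "N = Suc M" "j < M" by (cases N) auto
  have "flip_at (Suc j) \<otimes> fixed_vec N = shift (flip_at j) \<otimes> (S p \<oplus> S q) \<otimes> fixed_vec M"
    by (simp add: N flip_at_Suc m_assoc)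
  also have "\<dots> = (S p \<oplus> S q) \<otimes> (flip_at j \<otimes> fixed_vec M)"
    using p q by (simp add: l_distr r_distr shift_mult_gen m_assoc)
  finally show ?case using Suc.IH[OF N(2)] N(1) by simp
qed

text \<open>The summands of T may move flip indices by different amounts, so no single commutation
  relation survives addition. What survives is a loss of at most K at each end of an interval of
  flips fixing y. The bound \<open>j + K \<le> b\<close> avoids truncated subtraction.\<close>

definition flip_band :: "nat \<Rightarrow> 'a \<Rightarrow> bool" where
  "flip_band K T \<longleftrightarrow> (\<forall>a b. \<forall>y\<in>carrier A. (\<forall>j. a \<le> j \<and> j \<le> b \<longrightarrow> flip_at j \<otimes> y = y) \<longrightarrow>
     (\<forall>j. a + K \<le> j \<and> j + K \<le> b \<longrightarrow> flip_at j \<otimes> (T \<otimes> y) = T \<otimes> y))"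

lemma flip_bandD:
  assumes "flip_band K T" "y \<in> carrier A" "\<forall>j. a \<le> j \<and> j \<le> b \<longrightarrow> flip_at j \<otimes> y = y"
    and "a + K \<le> j" "j + K \<le> b"
  shows "flip_at j \<otimes> (T \<otimes> y) = T \<otimes> y"
  using assms unfolding flip_band_def by blast

lemma flip_bandI:
  assumes "\<And>a b y j. \<lbrakk>y \<in> carrier A; \<forall>j. a \<le> j \<and> j \<le> b \<longrightarrow> flip_at j \<otimes> y = y;
      a + K \<le> j; j + K \<le> b\<rbrakk> \<Longrightarrow> flip_at j \<otimes> (T \<otimes> y) = T \<otimes> y"
  shows "flip_band K T"
  using assms unfolding flip_band_def by blast

lemma flip_band_mono: "flip_band K T \<Longrightarrow> K \<le> L \<Longrightarrow> flip_band L T"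
  by (rule flip_bandI) (rule flip_bandD[of K T], auto)

lemma flip_band_add:
  assumes T: "flip_band K T" and U: "flip_band K U" and c: "T \<in> carrier A" "U \<in> carrier A"
  shows "flip_band K (T \<oplus> U)"
proof (rule flip_bandI)
  fix a b y j
  assume *: "y \<in> carrier A" "\<forall>j. a \<le> j \<and> j \<le> b \<longrightarrow> flip_at j \<otimes> y = y" "a + K \<le> j" "j + K \<le> b"
  show "flip_at j \<otimes> ((T \<oplus> U) \<otimes> y) = (T \<oplus> U) \<otimes> y"
    using flip_bandD[OF T *] flip_bandD[OF U *] *(1) c by (simp add: l_distr r_distr)
qed

lemma flip_band_smult:
  assumes T: "flip_band K T" and c: "T \<in> carrier A"
  shows "flip_band K (d \<odot> T)"
proof (rule flip_bandI)
  fix a b y j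
  assume *: "y \<in> carrier A" "\<forall>j. a \<le> j \<and> j \<le> b \<longrightarrow> flip_at j \<otimes> y = y" "a + K \<le> j" "j + K \<le> b"
  show "flip_at j \<otimes> (d \<odot> T \<otimes> y) = d \<odot> T \<otimes> y"
    using flip_bandD[OF T *] *(1) c by (simp add: smult_mult_left smult_mult_right)
qed

lemma flip_band_mult:
  assumes T: "flip_band K T" and U: "flip_band L U" and c: "T \<in> carrier A" "U \<in> carrier A"
  shows "flip_band (K + L) (T \<otimes> U)"
proof (rule flip_bandI)
  fix a b y j
  assume y: "y \<in> carrier A" "\<forall>j. a \<le> j \<and> j \<le> b \<longrightarrow> flip_at j \<otimes> y = y"
    and j: "a + (K + L) \<le> j" "j + (K + L) \<le> b"
  \<comment> \<open>After applying \<open>U\<close>, the flips from \<open>a + L\<close> to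
    \<open>b - L\<close> still fix the vector. The subtraction does not truncate because
    \<open>j + (K + L) \<le> b\<close>.\<close>
  have "\<forall>j. a + L \<le> j \<and> j \<le> b - L \<longrightarrow> flip_at j \<otimes> (U \<otimes> y) = U \<otimes> y"
    by (intro allI impI flip_bandD[OF U y]) (use j in auto)
  from flip_bandD[OF T _ this, of j] j y c
  show "flip_at j \<otimes> (T \<otimes> U \<otimes> y) = T \<otimes> U \<otimes> y" by (simp add: m_assoc)
qed

text \<open>A flip loses a shift when passing a generator and gains one when passing an adjoint, so
  its index moves by one in either case.\<close>

lemma flip_band_gen:
  assumes i: "i \<in> {1..n}"
  shows "flip_band 1 (S i)" "flip_band 1 (adj A (S i))"
proof -
  have Si: "S i \<in> carrier A" "adj A (S i) \<in> carrier A" using i by auto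
  show "flip_band 1 (S i)"
  proof (rule flip_bandI)
    fix a b y j
    assume y: "y \<in> carrier A" "\<forall>j. a \<le> j \<and> j \<le> b \<longrightarrow> flip_at j \<otimes> y = y"
      and j: "a + 1 \<le> j" "j + 1 \<le> b"
    then obtain m where m: "j = Suc m" by (cases j) auto
    have "flip_at j \<otimes> (S i \<otimes> y) = shift (flip_at m) \<otimes> S i \<otimes> y"
      using Si y by (simp add: m flip_at_Suc m_assoc)
    also have "\<dots> = S i \<otimes> (flip_at m \<otimes> y)" using Si y i by (simp add: shift_mult_gen m_assoc)
    finally show "flip_at j \<otimes> (S i \<otimes> y) = S i \<otimes> y" using y j m by simp
  qed
  show "flip_band 1 (adj A (S i))"
  proof (rule flip_bandI)
    fix a b y j
    assume y: "y \<in> carrier A" "\<forall>j. a \<le> j \<and> j \<le> b \<longrightarrow> flip_at j \<otimes> y = y"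
      and j: "a + 1 \<le> j" "j + 1 \<le> b"
    have "flip_at j \<otimes> (adj A (S i) \<otimes> y) = adj A (S i) \<otimes> shift (flip_at j) \<otimes> y"
      using Si y i by (simp add: adj_gen_mult_shift m_assoc)
    also have "\<dots> = adj A (S i) \<otimes> (flip_at (Suc j) \<otimes> y)"
      using Si y by (simp add: flip_at_Suc m_assoc)
    finally show "flip_at j \<otimes> (adj A (S i) \<otimes> y) = adj A (S i) \<otimes> y" using y j by simp
  qed
qed

text \<open>Asking for a band of the adjoint too makes this set closed under adjoints, as a
  star-subalgebra must be.\<close>

definition banded :: "'a set" where
  "banded = {T \<in> carrier A. \<exists>K. flip_band K T \<and> flip_band K (adj A T)}"

lemma star_subalgebra_banded: "star_subalgebra banded"
  unfolding star_subalgebra_def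
proof (intro conjI ballI allI)
  show "banded \<subseteq> carrier A" by (auto simp: banded_def)
  have "flip_band 0 \<one>" by (simp add: flip_band_def)
  then show "\<one> \<in> banded" by (auto simp: banded_def)
  fix T assume "T \<in> banded"
  then obtain K where T: "T \<in> carrier A" "flip_band K T" "flip_band K (adj A T)"
    by (auto simp: banded_def)
  show "c \<odot> T \<in> banded" for c
    using T(1) flip_band_smult[OF T(2,1), of c] flip_band_smult[OF T(3) adj_closed[OF T(1)], of "cnj c"]
    unfolding banded_def by (auto simp: adj_smult)
  show "adj A T \<in> banded" using T by (auto simp: banded_def adj_closed adj_adj)
  fix U assume "U \<in> banded"
  then obtain L where U: "U \<in> carrier A" "flip_band L U" "flip_band L (adj A U)"
    by (auto simp: banded_def)
  have T': "flip_band (K + L) T" "flip_band (K + L) (adj A T)"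
    using T flip_band_mono by auto
  have U': "flip_band (K + L) U" "flip_band (K + L) (adj A U)"
    using U flip_band_mono by auto
  have "flip_band (K + L) (T \<oplus> U)" "flip_band (K + L) (adj A T \<oplus> adj A U)"
    using T U T' U' by (auto intro!: flip_band_add adj_closed)
  then show "T \<oplus> U \<in> banded" using T(1) U(1) by (auto simp: banded_def adj_add)
  have "flip_band (K + L) (T \<otimes> U)" "flip_band (L + K) (adj A U \<otimes> adj A T)"
    using T U by (auto intro!: flip_band_mult adj_closed)
  then show "T \<otimes> U \<in> banded" using T(1) U(1) by (auto simp: banded_def adj_mult add.commute)
qed

lemma gens_banded: "S ` {1..n} \<subseteq> banded"
  using flip_band_gen gen_star_closed by (force simp: banded_def)

text \<open>The vectors \<open>fixed_vec N\<close> are fixed by \<open>flip_at j\<close> for \<open>j < N\<close>, and elements of a dense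
  subalgebra preserve this up to a bounded loss at both ends. So on such a vector \<open>y\<close> the relation
  forces \<open>T y\<close> to be close to \<open>- T y\<close>.\<close>

lemma no_isometry_anticommuting_with_flips:
  assumes gen: "carrier A = cstar_generated A (S ` {1..n})"
    and T: "T \<in> carrier A" "adj A T \<otimes> T = \<one>"
    and rel: "\<And>K. \<exists>k\<ge>K. T \<otimes> flip_at k = \<ominus> (flip_at (k + c) \<otimes> T)"
  shows False
proof -
  have "T \<in> norm_topology A closure_of banded"
    using cstar_generated_subset_closure[OF star_subalgebra_banded gens_banded] gen T by auto
  then obtain f where f: "\<forall>k. f k \<in> banded" "tends f T"
    using mem_closure_iff_tends[of banded T] by (auto simp: banded_def)
  \<comment> \<open>Distance below 1 is enough: the final estimate bounds |T z| by |U - T|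
    |z|.\<close>
  then obtain i where i: "nrm A (f i \<ominus> T) < 1"
    using tends_nrm_less[of f T 1] by auto
  define U where "U = f i"
  have "U \<in> banded" "nrm A (U \<ominus> T) < 1" using f i by (auto simp: U_def)
  then obtain K where U: "U \<in> carrier A" "nrm A (U \<ominus> T) < 1" "flip_band K U"
    by (auto simp: banded_def)
  obtain k where k: "k \<ge> K" "T \<otimes> flip_at k = \<ominus> (flip_at (k + c) \<otimes> T)" using rel by blast
  \<comment> \<open>The flips with index 0 to k + c + K fix \<open>z\<close>. After a loss of K at
    each end the index k + c remains, as \<open>k \<ge> K\<close>.\<close>
  define z where "z = fixed_vec (Suc (k + c + K))"
  have z: "z \<in> carrier A" "z \<noteq> \<zero>" by (simp_all add: z_def fixed_vec_neq_zero del: fixed_vec_Suc)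
  have fixz: "flip_at j \<otimes> z = z" if "j \<le> k + c + K" for j
    unfolding z_def using that by (intro flip_at_fixed_vec) simp
  let ?x = "flip_at (k + c)"
  have xU: "?x \<otimes> (U \<otimes> z) = U \<otimes> z"
    by (rule flip_bandD[OF U(3) z(1), of 0 "k + c + K"]) (use fixz k in auto)
  have "T \<otimes> z = T \<otimes> flip_at k \<otimes> z" using T z fixz[of k] by (simp add: m_assoc)
  also have "\<dots> = \<ominus> (?x \<otimes> (T \<otimes> z))" unfolding k(2) using T z by (simp add: l_minus m_assoc)
  finally have Tz: "T \<otimes> z = \<ominus> (?x \<otimes> (T \<otimes> z))" .
  let ?d = "(U \<ominus> T) \<otimes> z"
  have d: "?d \<in> carrier A" "T \<otimes> z \<in> carrier A" "U \<otimes> z \<in> carrier A" using U T z by auto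
  have "?d = U \<otimes> z \<ominus> T \<otimes> z" using U T z by (simp add: minus_eq l_distr l_minus)
  then have xd: "?x \<otimes> ?d = U \<otimes> z \<oplus> T \<otimes> z" and deq: "?d = U \<otimes> z \<ominus> T \<otimes> z"
    using d xU Tz by (simp_all add: minus_eq r_distr r_minus)
  \<comment> \<open>\<open>?x\<close> fixes U z and negates T z, so this difference isolates 2 T z.
    As \<open>?x\<close> has norm at most 1, |T z| <= |d| < |z|, although the isometry T preserves
    norms.\<close>
  have "?x \<otimes> ?d \<ominus> ?d = T \<otimes> z \<oplus> T \<otimes> z"
    unfolding xd unfolding deq using d by algebra
  also have "\<dots> = 2 \<odot> (T \<otimes> z)" using smult_l_distr[of 1 1 "T \<otimes> z"] d by simp
  finally have "2 * nrm A (T \<otimes> z) = nrm A (?x \<otimes> ?d \<ominus> ?d)"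
    using nrm_smult[OF d(2), of 2] by simp
  also have "\<dots> \<le> nrm A (?x \<otimes> ?d) + nrm A ?d" using d by (intro nrm_diff_triangle) auto
  also have "\<dots> \<le> 1 * nrm A ?d + nrm A ?d"
    using d nrm_flip_at_le[of "k + c"] nrm_nonneg[OF d(1)]
    by (intro add_right_mono order_trans[OF nrm_mult] mult_right_mono) auto
  also have "\<dots> \<le> 2 * (nrm A (U \<ominus> T) * nrm A z)"
    using nrm_mult[of "U \<ominus> T" z] U T z by simp
  also have "\<dots> < 2 * (1 * nrm A z)"
    using U z nrm_nonneg[OF z(1)] nrm_eq_zero[OF z(1)] by (intro mult_strict_left_mono mult_strict_right_mono) auto
  finally show False using nrm_isometry_mult[OF T(1) z(1) T(2)] by simp
qed

end

section \<open>Automorphisms of the core\<close>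

context cuntz_family
begin

section \<open>Restrictions and inner automorphisms of the core\<close>

lemma core_closed:
  shows core_subset: "carrier (core n A S) \<subseteq> carrier A"
    and core_one: "\<one> \<in> carrier (core n A S)"
    and core_add: "\<lbrakk>x \<in> carrier (core n A S); y \<in> carrier (core n A S)\<rbrakk> \<Longrightarrow> x \<oplus> y \<in> carrier (core n A S)"
    and core_mult: "\<lbrakk>x \<in> carrier (core n A S); y \<in> carrier (core n A S)\<rbrakk> \<Longrightarrow> x \<otimes> y \<in> carrier (core n A S)"
    and core_smult: "x \<in> carrier (core n A S) \<Longrightarrow> c \<odot> x \<in> carrier (core n A S)"
    and core_adj: "x \<in> carrier (core n A S) \<Longrightarrow> adj A x \<in> carrier (core n A S)"
    and core_tends: "\<lbrakk>\<And>k. f k \<in> carrier (core n A S); tends f x\<rbrakk> \<Longrightarrow> x \<in> carrier (core n A S)"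
  using cstar_subalgebra_core
  unfolding cstar_subalgebra_iff star_subalgebra_def closedin_norm_topology_iff by blast+

lemma restriction_map_in_Aut:
  assumes "\<beta> \<in> Aut_pair A (core n A S)"
  shows "restriction_map (core n A S) \<beta> \<in> Aut (core n A S)"
proof -
  let ?F = "carrier (core n A S)"
  have h: "\<beta> \<in> star_hom A A" and inj: "inj_on \<beta> (carrier A)" and im: "\<beta> ` ?F = ?F"
    using assms by (auto simp: Aut_pair_def Aut_def Bij_def bij_betw_def)
  have "restrict \<beta> ?F \<in> star_hom (core n A S) (core n A S)"
  proof (rule star_homI)
    fix x assume x: "x \<in> ?F"
    then have xA: "x \<in> carrier A" using core_subset by auto
    show "restrict \<beta> ?F x \<in> ?F" using x im by auto
    show "restrict \<beta> ?F (c \<odot>\<^bsub>core n A S\<^esub> x) = c \<odot>\<^bsub>core n A S\<^esub> restrict \<beta> ?F x" for c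
      using x xA core_smult star_homD(5)[OF h] by simp
    show "restrict \<beta> ?F (adj (core n A S) x) = adj (core n A S) (restrict \<beta> ?F x)"
      using x xA core_adj star_homD(6)[OF h] by simp
    fix y assume y: "y \<in> ?F"
    then have yA: "y \<in> carrier A" using core_subset by auto
    show "restrict \<beta> ?F (x \<otimes>\<^bsub>core n A S\<^esub> y) = restrict \<beta> ?F x \<otimes>\<^bsub>core n A S\<^esub> restrict \<beta> ?F y"
      using x y xA yA core_mult star_homD(2)[OF h] by simp
    show "restrict \<beta> ?F (x \<oplus>\<^bsub>core n A S\<^esub> y) = restrict \<beta> ?F x \<oplus>\<^bsub>core n A S\<^esub> restrict \<beta> ?F y"
      using x y xA yA core_add star_homD(3)[OF h] by simp
  qed (use core_one star_homD(4)[OF h] in simp)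
  moreover have "restrict \<beta> ?F \<in> Bij ?F"
    using im inj_on_subset[OF inj core_subset] by (auto simp: Bij_def bij_betw_def inj_on_def)
  ultimately show ?thesis by (simp add: Aut_def restriction_map_def)
qed

text \<open>A unitary of the core is a unitary of A, so its conjugation extends to A, with
  conjugation by the adjoint as inverse, and both preserve the core. This places the inner
  automorphisms in the image of the restriction map.\<close>

lemma Ad_in_Aut_pair:
  assumes u: "u \<in> unitaries (core n A S)"
  shows "Ad A u \<in> Aut_pair A (core n A S)"
proof -
  let ?F = "carrier (core n A S)"
  have uF: "u \<in> ?F" "adj A u \<in> ?F" and uu: "adj A u \<otimes> u = \<one>" "u \<otimes> adj A u = \<one>"
    using u core_adj by (auto simp: unitaries_def)
  have uA: "u \<in> carrier A" "adj A u \<in> carrier A" using uF core_subset by auto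
  have uu': "adj A u \<otimes> (u \<otimes> x) = x" "u \<otimes> (adj A u \<otimes> x) = x" if "x \<in> carrier A" for x
    using uA uu that by (simp_all flip: m_assoc)
  have "Ad A u \<in> star_hom A A"
    by (rule star_homI)
      (use uA uu uu' in \<open>auto simp: Ad_def adj_closed l_distr r_distr smult_mult_left smult_mult_right adj_mult adj_adj m_assoc\<close>)
  moreover have inv: "Ad A u (Ad A (adj A u) x) = x" "Ad A (adj A u) (Ad A u x) = x"
    if "x \<in> carrier A" for x
    using that uA uu uu' by (simp_all add: Ad_def adj_adj m_assoc)
  moreover have cl: "Ad A u x \<in> carrier A" "Ad A (adj A u) x \<in> carrier A" if "x \<in> carrier A" for x
    using that uA by (simp_all add: Ad_def adj_adj)
  have "bij_betw (Ad A u) (carrier A) (carrier A)"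
    by (rule bij_betw_byWitness[where f' = "Ad A (adj A u)"]) (use inv cl in auto)
  moreover have "Ad A u \<in> extensional (carrier A)" by (simp add: Ad_def)
  moreover have "Ad A u ` ?F = ?F"
  proof
    have F: "Ad A u x \<in> ?F" "Ad A (adj A u) x \<in> ?F" if "x \<in> ?F" for x
      using that uF core_subset core_mult by (auto simp: Ad_def adj_adj uA)
    then show "Ad A u ` ?F \<subseteq> ?F" by auto
    show "?F \<subseteq> Ad A u ` ?F"
    proof
      fix x assume x: "x \<in> ?F"
      then show "x \<in> Ad A u ` ?F"
        using inv(1)[of x] F(2)[OF x] core_subset by (metis imageI subsetD)
    qed
  qed
  ultimately show ?thesis by (simp add: Aut_pair_def Aut_def Bij_def)
qed

lemma restriction_map_Ad: "restriction_map (core n A S) (Ad A u) = Ad (core n A S) u"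
  using core_subset by (auto simp: restriction_map_def Ad_def fun_eq_iff restrict_def)

end

section \<open>The alternating automorphism of the core\<close>

context cuntz_pair
begin

text \<open>This is 1 - 2 P for the projection \<open>P = S p \<otimes> adj A (S p)\<close>, with
  the double term written as a sum so that ring identities suffice for computing with it.\<close>

definition reflection :: 'a where
  "reflection = \<one> \<ominus> (S p \<otimes> adj A (S p) \<oplus> S p \<otimes> adj A (S p))"

lemma reflection_closed [simp]: "reflection \<in> carrier A"
  by (simp add: reflection_def)

lemma adj_reflection [simp]: "adj A reflection = reflection"
  by (simp add: reflection_def adj_diff adj_add adj_mult adj_adj)

lemma reflection_mult_gens:
  "reflection \<otimes> S p = \<ominus> S p" "reflection \<otimes> S q = S q"
  "adj A (S p) \<otimes> reflection = \<ominus> adj A (S p)" "adj A (S q) \<otimes> reflection = adj A (S q)"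
  by (simp_all add: reflection_def minus_eq l_distr r_distr l_minus r_minus m_assoc minus_add r_neg2 r_neg1)

lemma reflection_square [simp]: "reflection \<otimes> reflection = \<one>"
proof -
  have "reflection \<otimes> reflection
      = reflection \<ominus> (reflection \<otimes> S p \<otimes> adj A (S p) \<oplus> reflection \<otimes> S p \<otimes> adj A (S p))"
    by (subst (2) reflection_def) (simp add: minus_eq r_distr r_minus m_assoc)
  also have "\<dots> = \<one>"
    unfolding reflection_mult_gens
    by (simp add: reflection_def minus_eq l_minus minus_add a_assoc r_neg1 r_neg2 l_neg)
  finally show ?thesis .
qed

text \<open>Each summand of the flip contains exactly one of \<open>S p\<close> and its adjoint, and
  the reflection negates these while leaving \<open>S q\<close> and its adjoint alone.\<close>

lemma reflection_conj_flip: "reflection \<otimes> flip \<otimes> reflection = \<ominus> flip"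
proof -
  have "reflection \<otimes> flip \<otimes> reflection
      = (reflection \<otimes> S p) \<otimes> (adj A (S q) \<otimes> reflection) \<oplus> (reflection \<otimes> S q) \<otimes> (adj A (S p) \<otimes> reflection)"
    by (simp add: flip_def l_distr r_distr m_assoc)
  then show ?thesis by (simp add: reflection_mult_gens flip_def l_minus r_minus minus_add)
qed

lemma unit_in_level_one:
  assumes "i \<in> {1..n}" "j \<in> {1..n}"
  shows "S i \<otimes> adj A (S j) \<in> matrix_level n A S (Suc 0)"
  using matrix_unit_in_level[of "[i]" "Suc 0" "[j]"] assms by simp

lemma flip_in_level: "flip \<in> matrix_level n A S (Suc 0)"
  unfolding flip_def using p q by (intro matrix_level_add unit_in_level_one)

lemma reflection_in_level: "reflection \<in> matrix_level n A S (Suc 0)"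
proof -
  have "reflection = \<one> \<oplus> (-1) \<odot> (S p \<otimes> adj A (S p) \<oplus> S p \<otimes> adj A (S p))"
    by (simp add: reflection_def minus_eq minus_one_smult)
  also have "\<dots> \<in> matrix_level n A S (Suc 0)"
    using p by (intro matrix_level_add matrix_level_smult one_in_matrix_level unit_in_level_one)
  finally show ?thesis .
qed

lemma shift_pow_in_level:
  "x \<in> matrix_level n A S (Suc 0) \<Longrightarrow> (shift ^^ k) x \<in> matrix_level n A S (Suc k)"
  by (induction k) (auto intro: matrix_level_shift)

lemma flip_at_in_core: "flip_at k \<in> carrier (core n A S)"
  using shift_pow_in_level[OF flip_in_level, of k] matrix_level_subset_core_algebra core_algebra_subset_core
  unfolding flip_at_def by blast

text \<open>Tensor positions are counted from 0: \<open>alt_step k\<close> acts on position k alone,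
  and \<open>alt_sgn k\<close> on the positions below k.\<close>

definition alt_step :: "nat \<Rightarrow> 'a" where
  "alt_step k = (shift ^^ k) (if odd k then reflection else \<one>)"

primrec alt_sgn :: "nat \<Rightarrow> 'a" where
  "alt_sgn 0 = \<one>"
| alt_sgn_Suc: "alt_sgn (Suc k) = alt_sgn k \<otimes> alt_step k"

lemma alt_step_closed [simp]: "alt_step k \<in> carrier A"
  by (simp add: alt_step_def)

lemma alt_sgn_in_level: "alt_sgn k \<in> matrix_level n A S k"
proof (induction k)
  case (Suc k)
  have "alt_step k \<in> matrix_level n A S (Suc k)"
    unfolding alt_step_def using reflection_in_level one_in_matrix_level
    by (intro shift_pow_in_level) simp
  then show ?case using matrix_level_Suc[OF Suc] by (simp add: matrix_level_mult)
qed (use one_in_matrix_level in simp)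

lemma alt_sgn_closed [simp]: "alt_sgn k \<in> carrier A"
  using alt_sgn_in_level matrix_level_closed by blast

lemma alt_step_square: "alt_step k \<otimes> alt_step k = \<one>"
  by (simp add: alt_step_def flip: shift_pow_mult)

lemma adj_alt_step: "adj A (alt_step k) = alt_step k"
  by (simp add: alt_step_def shift_pow_adj)

text \<open>For \<open>l \<ge> k\<close> an l-fold shift is also a k-fold shift, and those commute
  with level k.\<close>

lemma alt_step_commutes:
  assumes "x \<in> matrix_level n A S k" "k \<le> l"
  shows "alt_step l \<otimes> x = x \<otimes> alt_step l"
proof -
  have "(shift ^^ l) y = (shift ^^ k) ((shift ^^ (l - k)) y)" for y
    using assms(2) by (simp add: funpow_add[symmetric, THEN fun_cong, simplified o_apply])
  then show ?thesis
    unfolding alt_step_def using assms(1) by (simp add: shift_pow_commutes_matrix_level)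
qed

lemma alt_sgn_Suc': "alt_sgn (Suc k) = alt_step k \<otimes> alt_sgn k"
  using alt_step_commutes[OF alt_sgn_in_level, of k k] by (simp only: alt_sgn_Suc order_refl)

lemma adj_alt_sgn: "adj A (alt_sgn k) = alt_sgn k"
proof (induction k)
  case (Suc k)
  then show ?case by (subst alt_sgn_Suc) (simp add: adj_mult adj_alt_step alt_sgn_Suc' del: alt_sgn.simps)
qed simp

lemma alt_sgn_square: "alt_sgn k \<otimes> alt_sgn k = \<one>"
proof (induction k)
  case (Suc k)
  have "alt_sgn (Suc k) \<otimes> alt_sgn (Suc k) = alt_sgn k \<otimes> (alt_step k \<otimes> alt_step k) \<otimes> alt_sgn k"
    by (subst alt_sgn_Suc, subst alt_sgn_Suc') (simp add: m_assoc)
  then show ?case using Suc by (simp add: alt_step_square)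
qed simp

lemma alt_sgn_square_mult: "x \<in> carrier A \<Longrightarrow> alt_sgn k \<otimes> (alt_sgn k \<otimes> x) = x"
  using alt_sgn_square[of k] by (simp flip: m_assoc)

text \<open>Since \<open>alt_sgn k\<close> is a self-adjoint unitary, this is a unitary conjugation
  that is its own inverse.\<close>

definition alt_conj :: "nat \<Rightarrow> 'a \<Rightarrow> 'a" where
  "alt_conj k x = alt_sgn k \<otimes> x \<otimes> alt_sgn k"

lemma alt_conj_closed [simp]: "x \<in> carrier A \<Longrightarrow> alt_conj k x \<in> carrier A"
  by (simp add: alt_conj_def)

lemma alt_conj_mult:
  "\<lbrakk>x \<in> carrier A; y \<in> carrier A\<rbrakk> \<Longrightarrow> alt_conj k (x \<otimes> y) = alt_conj k x \<otimes> alt_conj k y"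
  by (simp add: alt_conj_def m_assoc alt_sgn_square_mult)

lemma alt_conj_add:
  "\<lbrakk>x \<in> carrier A; y \<in> carrier A\<rbrakk> \<Longrightarrow> alt_conj k (x \<oplus> y) = alt_conj k x \<oplus> alt_conj k y"
  by (simp add: alt_conj_def l_distr r_distr)

lemma alt_conj_smult: "x \<in> carrier A \<Longrightarrow> alt_conj k (c \<odot> x) = c \<odot> alt_conj k x"
  by (simp add: alt_conj_def smult_mult_left smult_mult_right)

lemma alt_conj_diff:
  "\<lbrakk>x \<in> carrier A; y \<in> carrier A\<rbrakk> \<Longrightarrow> alt_conj k (x \<ominus> y) = alt_conj k x \<ominus> alt_conj k y"
  by (simp add: alt_conj_def minus_eq l_distr r_distr l_minus r_minus)

lemma alt_conj_adj: "x \<in> carrier A \<Longrightarrow> alt_conj k (adj A x) = adj A (alt_conj k x)"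
  by (simp add: alt_conj_def adj_mult adj_closed adj_alt_sgn m_assoc)

lemma alt_conj_alt_conj: "x \<in> carrier A \<Longrightarrow> alt_conj k (alt_conj k x) = x"
  by (simp add: alt_conj_def m_assoc alt_sgn_square_mult alt_sgn_square)

text \<open>Left multiplication by the unitary preserves norms; right multiplication is reduced to
  it by taking adjoints.\<close>

lemma nrm_alt_conj: "x \<in> carrier A \<Longrightarrow> nrm A (alt_conj k x) = nrm A x"
proof -
  assume x: "x \<in> carrier A"
  have iso: "adj A (alt_sgn k) \<otimes> alt_sgn k = \<one>" by (simp add: adj_alt_sgn alt_sgn_square)
  have "nrm A (alt_conj k x) = nrm A (x \<otimes> alt_sgn k)"
    using x iso by (simp add: alt_conj_def m_assoc nrm_isometry_mult)
  also have "\<dots> = nrm A (adj A (x \<otimes> alt_sgn k))" using x by simp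
  also have "adj A (x \<otimes> alt_sgn k) = alt_sgn k \<otimes> adj A x" using x by (simp add: adj_mult adj_alt_sgn)
  also have "nrm A \<dots> = nrm A x" using x iso by (simp add: nrm_isometry_mult adj_closed)
  finally show ?thesis .
qed

text \<open>The factors at positions from k on commute with x and square to 1, so they cancel around
  x.\<close>

lemma alt_conj_stable:
  assumes "x \<in> matrix_level n A S k" "k \<le> l"
  shows "alt_conj l x = alt_conj k x"
  using assms(2)
proof (induction l rule: dec_induct)
  case (step l)
  have x: "x \<in> carrier A" using assms(1) matrix_level_closed by auto
  have "alt_conj (Suc l) x = alt_sgn l \<otimes> (alt_step l \<otimes> x \<otimes> alt_step l) \<otimes> alt_sgn l"
    unfolding alt_conj_def by (subst alt_sgn_Suc, subst alt_sgn_Suc') (simp add: m_assoc x)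
  also have "alt_step l \<otimes> x \<otimes> alt_step l = x"
    using alt_step_commutes[OF assms(1) step(1)] x by (simp add: m_assoc alt_step_square)
  finally show ?case using step by (simp add: alt_conj_def)
qed simp

text \<open>The conjugations are isometric and eventually constant on each level, and the levels are
  dense in the core. Comparison with a nearby element of a level gives the Cauchy property.\<close>

lemma alt_conj_converges:
  assumes x: "x \<in> carrier (core n A S)"
  shows "\<exists>l. tends (\<lambda>k. alt_conj k x) l"
proof (rule Cauchy_tends)
  have xA: "x \<in> carrier A" using x core_subset by auto
  then show "alt_conj k x \<in> carrier A" for k by simp
  fix \<epsilon> :: real assume e: "\<epsilon> > 0"
  obtain f where f: "\<forall>k. f k \<in> core_algebra" "tends f x" using x mem_core_iff_tends by blast
  obtain i where i: "nrm A (f i \<ominus> x) < \<epsilon> / 2" using tends_nrm_less[OF f(2), of "\<epsilon> / 2"] e by auto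
  define y where "y = f i"
  obtain N where N: "y \<in> matrix_level n A S N" using f(1) by (auto simp: core_algebra_def y_def)
  then have yA: "y \<in> carrier A" using matrix_level_closed by auto
  have d: "nrm A (alt_conj k y \<ominus> alt_conj k x) < \<epsilon> / 2" for k
    using i xA yA by (simp add: nrm_alt_conj y_def flip: alt_conj_diff)
  show "\<exists>N. \<forall>i\<ge>N. \<forall>j\<ge>N. nrm A (alt_conj i x \<ominus> alt_conj j x) < \<epsilon>"
  proof (intro exI[of _ N] allI impI)
    fix i j assume ij: "i \<ge> N" "j \<ge> N"
    have "nrm A (alt_conj i x \<ominus> alt_conj j x)
        \<le> nrm A (alt_conj i x \<ominus> alt_conj i y) + nrm A (alt_conj i y \<ominus> alt_conj j x)"
      using xA yA by (intro nrm_diff_trans) auto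
    moreover have "nrm A (alt_conj i x \<ominus> alt_conj i y) < \<epsilon> / 2"
      using d[of i] nrm_diff_commute[of "alt_conj i x" "alt_conj i y"] xA yA by simp
    moreover have "nrm A (alt_conj i y \<ominus> alt_conj j x) < \<epsilon> / 2"
      using d[of j] by (simp only: alt_conj_stable[OF N ij(1)] alt_conj_stable[OF N ij(2)])
    ultimately show "nrm A (alt_conj i x \<ominus> alt_conj j x) < \<epsilon>" by linarith
  qed
qed

text \<open>The choice picks the limit, which exists by \<open>alt_conj_converges\<close> and is
  unique. Restricting to the core supplies the extensionality demanded by
  \<open>Aut\<close>.\<close>

definition alt_aut :: "'a \<Rightarrow> 'a" where
  "alt_aut = (\<lambda>x\<in>carrier (core n A S). SOME l. tends (\<lambda>k. alt_conj k x) l)"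

lemma alt_aut_tends:
  "x \<in> carrier (core n A S) \<Longrightarrow> tends (\<lambda>k. alt_conj k x) (alt_aut x)"
  using someI_ex[OF alt_conj_converges] by (simp add: alt_aut_def)

lemma alt_aut_eqI:
  "\<lbrakk>x \<in> carrier (core n A S); tends (\<lambda>k. alt_conj k x) l\<rbrakk> \<Longrightarrow> alt_aut x = l"
  using alt_aut_tends tends_unique by blast

lemma alt_sgn_in_core: "alt_sgn k \<in> carrier (core n A S)"
  using alt_sgn_in_level matrix_level_subset_core_algebra core_algebra_subset_core by blast

lemma alt_aut_in_core: "x \<in> carrier (core n A S) \<Longrightarrow> alt_aut x \<in> carrier (core n A S)"
  by (rule core_tends[OF _ alt_aut_tends]) (auto simp: alt_conj_def intro!: core_mult alt_sgn_in_core)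

lemma alt_aut_alt_aut:
  assumes x: "x \<in> carrier (core n A S)"
  shows "alt_aut (alt_aut x) = x"
proof (rule alt_aut_eqI[OF alt_aut_in_core[OF x]])
  have c: "x \<in> carrier A" "alt_aut x \<in> carrier A" using x alt_aut_in_core core_subset by auto
  show "tends (\<lambda>k. alt_conj k (alt_aut x)) x"
  proof (rule tendsI_le)
    fix k
    \<comment> \<open>The conjugation is isometric and involutive, so
      \<open>alt_conj k (alt_aut x)\<close> is as far from \<open>x\<close> as
      \<open>alt_conj k x\<close> is from \<open>alt_aut x\<close>.\<close>
    have "alt_conj k (alt_aut x) \<ominus> x = alt_conj k (alt_aut x \<ominus> alt_conj k x)"
      using c by (simp add: alt_conj_diff alt_conj_alt_conj)
    then show "nrm A (alt_conj k (alt_aut x) \<ominus> x) \<le> nrm A (alt_conj k x \<ominus> alt_aut x)"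
      using c nrm_diff_commute[of "alt_aut x" "alt_conj k x"] by (simp add: nrm_alt_conj)
  next
    show "(\<lambda>k. nrm A (alt_conj k x \<ominus> alt_aut x)) \<longlonglongrightarrow> 0"
      using alt_aut_tends[OF x] by (simp add: tends_def)
  qed (use c in auto)
qed

lemma alt_aut_in_Aut: "alt_aut \<in> Aut (core n A S)"
proof -
  let ?F = "carrier (core n A S)"
  have "alt_aut \<in> star_hom (core n A S) (core n A S)"
  proof (rule star_homI)
    show "alt_aut \<one>\<^bsub>core n A S\<^esub> = \<one>\<^bsub>core n A S\<^esub>"
      using tends_const[of \<one>] core_one by (intro alt_aut_eqI) (auto simp: alt_conj_def alt_sgn_square)
    fix x assume x: "x \<in> ?F"
    then have xA: "x \<in> carrier A" using core_subset by auto
    show "alt_aut x \<in> ?F" by (rule alt_aut_in_core[OF x])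
    show "alt_aut (c \<odot>\<^bsub>core n A S\<^esub> x) = c \<odot>\<^bsub>core n A S\<^esub> alt_aut x" for c
      using tends_smult[OF alt_aut_tends[OF x], of c] core_smult[OF x] xA
      by (intro alt_aut_eqI) (auto simp: alt_conj_smult)
    show "alt_aut (adj (core n A S) x) = adj (core n A S) (alt_aut x)"
      using tends_adj[OF alt_aut_tends[OF x]] core_adj[OF x] xA
      by (intro alt_aut_eqI) (auto simp: alt_conj_adj)
    fix y assume y: "y \<in> ?F"
    then have yA: "y \<in> carrier A" using core_subset by auto
    show "alt_aut (x \<otimes>\<^bsub>core n A S\<^esub> y) = alt_aut x \<otimes>\<^bsub>core n A S\<^esub> alt_aut y"
      using tends_mult[OF alt_aut_tends[OF x] alt_aut_tends[OF y]] core_mult[OF x y] xA yA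
      by (intro alt_aut_eqI) (auto simp: alt_conj_mult)
    show "alt_aut (x \<oplus>\<^bsub>core n A S\<^esub> y) = alt_aut x \<oplus>\<^bsub>core n A S\<^esub> alt_aut y"
      using tends_add[OF alt_aut_tends[OF x] alt_aut_tends[OF y]] core_add[OF x y] xA yA
      by (intro alt_aut_eqI) (auto simp: alt_conj_add)
  qed
  moreover have "bij_betw alt_aut ?F ?F"
    by (rule bij_betw_byWitness[where f' = alt_aut]) (use alt_aut_alt_aut alt_aut_in_core in auto)
  moreover have "alt_aut \<in> extensional ?F" by (simp add: alt_aut_def)
  ultimately show ?thesis by (simp add: Aut_def Bij_def)
qed

text \<open>The flip commutes with the factors below position k, so only the factor at position k
  acts, with a sign when k is odd. From \<open>Suc k\<close> on the conjugations are constant on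
  it.\<close>

lemma alt_aut_flip_at: "alt_aut (flip_at k) = (if odd k then \<ominus> flip_at k else flip_at k)"
proof (rule alt_aut_eqI[OF flip_at_in_core])
  let ?l = "if odd k then \<ominus> flip_at k else flip_at k"
  have lvl: "flip_at k \<in> matrix_level n A S (Suc k)"
    unfolding flip_at_def by (rule shift_pow_in_level[OF flip_in_level])
  have comm: "flip_at k \<otimes> alt_sgn k = alt_sgn k \<otimes> flip_at k"
    unfolding flip_at_def by (rule shift_pow_commutes_matrix_level[OF flip_closed alt_sgn_in_level])
  have "alt_step k \<otimes> flip_at k \<otimes> alt_step k = ?l"
    by (simp add: alt_step_def flip_at_def reflection_conj_flip shift_pow_minus flip: shift_pow_mult)
  moreover have "alt_conj (Suc k) (flip_at k) = alt_sgn k \<otimes> (alt_step k \<otimes> flip_at k \<otimes> alt_step k) \<otimes> alt_sgn k"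
    unfolding alt_conj_def by (subst alt_sgn_Suc, subst alt_sgn_Suc') (simp add: m_assoc)
  ultimately have "alt_conj (Suc k) (flip_at k) = alt_sgn k \<otimes> ?l \<otimes> alt_sgn k" by simp
  also have "\<dots> = ?l"
    by (simp add: l_minus r_minus m_assoc comm alt_sgn_square_mult)
  finally have eq: "alt_conj (Suc k) (flip_at k) = ?l" .
  show "tends (\<lambda>l. alt_conj l (flip_at k)) ?l"
  proof (rule tends_eventually_const[where N = "Suc k"])
    show "alt_conj i (flip_at k) = ?l" if "i \<ge> Suc k" for i
      using alt_conj_stable[OF lvl that] eq by (rule trans)
  qed auto
qed

lemma alt_aut_not_restriction:
  assumes gen: "carrier A = cstar_generated A (S ` {1..n})"
  shows "alt_aut \<notin> restriction_map (core n A S) ` Aut_pair A (core n A S)"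
proof
  assume "alt_aut \<in> restriction_map (core n A S) ` Aut_pair A (core n A S)"
  then obtain \<beta> where \<beta>: "\<beta> \<in> star_hom A A" and r: "alt_aut = restrict \<beta> (carrier (core n A S))"
    by (auto simp: Aut_pair_def Aut_def restriction_map_def)
  note D = star_homD[OF \<beta>]
  have \<beta>_flip: "\<beta> (flip_at k) = (if odd k then \<ominus> flip_at k else flip_at k)" for k
    using alt_aut_flip_at[of k] flip_at_in_core[of k] r by simp
  let ?T = "\<beta> (S p)"
  have T: "?T \<in> carrier A" using D(1) by simp
  have "adj A ?T \<otimes> ?T = \<beta> (adj A (S p) \<otimes> S p)" using D(2)[of "adj A (S p)" "S p"] D(6)[of "S p"] by simp
  then have iso: "adj A ?T \<otimes> ?T = \<one>" using D(4) by simp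
  \<comment> \<open>For even k the flips of index k and k + 1 receive opposite signs. This turns the
    intertwining relation of \<open>S p\<close> into anticommutation with index offset 1.\<close>
  have rel: "?T \<otimes> flip_at k = \<ominus> (flip_at (k + 1) \<otimes> ?T)" if "even k" for k
  proof -
    have "?T \<otimes> flip_at k = ?T \<otimes> \<beta> (flip_at k)" using \<beta>_flip that by simp
    also have "\<dots> = \<beta> (S p \<otimes> flip_at k)" using D(2) by simp
    also have "S p \<otimes> flip_at k = flip_at (Suc k) \<otimes> S p"
      using p by (simp add: flip_at_Suc shift_mult_gen)
    also have "\<beta> \<dots> = \<beta> (flip_at (Suc k)) \<otimes> ?T" using D(2) by simp
    finally show ?thesis using \<beta>_flip[of "Suc k"] that T by (simp add: l_minus)
  qed
  \<comment> \<open>The index \<open>2 * K\<close> is even and at least \<open>K\<close>.\<close>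
  have "\<exists>k\<ge>K. ?T \<otimes> flip_at k = \<ominus> (flip_at (k + 1) \<otimes> ?T)" for K
    using rel[of "2 * K"] by (intro exI[of _ "2 * K"]) simp
  then show False by (rule no_isometry_anticommuting_with_flips[OF gen T iso])
qed

section \<open>The sign change automorphism\<close>

lemma cuntz_family_sign_change: "cuntz_family n A (S(p := \<ominus> S p))"
proof
  fix i assume i: "i \<in> {1..n}"
  show "(S(p := \<ominus> S p)) i \<in> carrier A" using i by simp
  show "adj A ((S(p := \<ominus> S p)) i) \<otimes> (S(p := \<ominus> S p)) i = \<one>"
    using i isometry by (simp add: adj_minus l_minus r_minus)
next
  \<comment> \<open>The sign occurs both in the generator and in its adjoint, and cancels.\<close>
  have "(\<Oplus>i\<in>{1..n}. (S(p := \<ominus> S p)) i \<otimes> adj A ((S(p := \<ominus> S p)) i))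
      = (\<Oplus>i\<in>{1..n}. S i \<otimes> adj A (S i))"
    by (intro finsum_cong') (auto simp: adj_minus l_minus r_minus)
  then show "(\<Oplus>i\<in>{1..n}. (S(p := \<ominus> S p)) i \<otimes> adj A ((S(p := \<ominus> S p)) i)) = \<one>"
    by (simp only: range_sum)
qed

text \<open>Fixing or negating each generator makes h an involution that multiplies words by scalars
  and commutes with the shift, so it preserves the levels and the core. It negates every flip, and a
  unitary of the core implementing it would anticommute with all of them.\<close>

lemma sign_change_not_inner:
  assumes gen: "carrier A = cstar_generated A (S ` {1..n})"
    and h: "h \<in> star_hom A A" and hS: "\<forall>i\<in>{1..n}. h (S i) = (S(p := \<ominus> S p)) i"
  shows "restrict h (carrier A) \<in> Aut_pair A (core n A S)"
    and "restriction_map (core n A S) (restrict h (carrier A)) \<notin> Inn (core n A S)"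
proof -
  let ?F = "carrier (core n A S)"
  note D = star_homD[OF h]
  have hp: "h (S p) = \<ominus> S p" using hS p by simp
  have hi: "h (S i) = S i" if "i \<in> {1..n}" "i \<noteq> p" for i using hS that by simp
  have hm: "h (\<ominus> x) = \<ominus> h x" if "x \<in> carrier A" for x
    using D(5)[of x "-1"] that D(1)[of x] by (simp add: minus_one_smult)
  have hh_gen: "h (h (S i)) = S i" if "i \<in> {1..n}" for i
    using that hp hi[of i] hm[of "S p"] by (cases "i = p") auto
  have hh_hom: "(\<lambda>x. h (h x)) \<in> star_hom A A" by (rule star_homI) (simp_all add: D)
  have id_hom: "(\<lambda>x. x) \<in> star_hom A A" by (rule star_homI) auto
  \<comment> \<open>The square of h and the identity agree on the generators, hence everywhere, so h
    is its own inverse.\<close>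
  have hh: "h (h x) = x" if x: "x \<in> carrier A" for x
    by (rule star_hom_eq_on_generated[OF hh_hom id_hom, of "S ` {1..n}"])
      (use hh_gen gen x in auto)
  \<comment> \<open>The scalar is the product of the signs of the letters; its existence is enough
    to keep matrix units inside the span of their level.\<close>
  have word: "\<exists>c. h (gen_word A S w) = c \<odot> gen_word A S w" if "set w \<subseteq> {1..n}" for w
    using that
  proof (induction w)
    case Nil
    show ?case using D(4) by (intro exI[of _ 1]) simp
  next
    case (Cons i w)
    then obtain c where c: "h (gen_word A S w) = c \<odot> gen_word A S w" by auto
    have i: "i \<in> {1..n}" "S i \<in> carrier A" and w: "gen_word A S w \<in> carrier A" using Cons by auto
    obtain d where d: "h (S i) = d \<odot> S i"
    proof (cases "i = p")
      case True
      then show ?thesis using that[of "-1"] hp by (simp add: minus_one_smult)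
    next
      case False
      then show ?thesis using that[of 1] hi[OF i(1)] i by simp
    qed
    have "h (gen_word A S (i # w)) = (d \<odot> S i) \<otimes> (c \<odot> gen_word A S w)"
      using i w D(2) c d by simp
    also have "\<dots> = (d * c) \<odot> gen_word A S (i # w)"
      using i w smult_assoc1[of c d "S i \<otimes> gen_word A S w"]
      by (simp add: smult_mult_left smult_mult_right mult.commute)
    finally show ?case ..
  qed
  have lvl: "h x \<in> matrix_level n A S k" if "x \<in> matrix_level n A S k" for x k
    using that
  proof (induction rule: matrix_level_induct)
    case zero
    then show ?case using D(5)[of \<zero> 0] D(1)[of \<zero>] matrix_level_zero by simp
  next
    case (base x)
    then obtain v w where *: "x = gen_word A S v \<otimes> adj A (gen_word A S w)"
      "length v = k" "length w = k" "set v \<subseteq> {1..n}" "set w \<subseteq> {1..n}"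
      by (auto simp: matrix_units_def)
    obtain c d where cd: "h (gen_word A S v) = c \<odot> gen_word A S v" "h (gen_word A S w) = d \<odot> gen_word A S w"
      using word *(4,5) by blast
    have cl: "gen_word A S v \<in> carrier A" "gen_word A S w \<in> carrier A" "adj A (gen_word A S w) \<in> carrier A"
      using *(4,5) by (auto simp: adj_closed)
    have "h x = cnj d \<odot> (c \<odot> x)"
      using *(1) cl cd D(2,6) by (simp add: adj_smult smult_mult_left smult_mult_right)
    then show ?case using matrix_level_smult matrix_level_base[OF base] by simp
  qed (auto simp: D intro: matrix_level_add matrix_level_smult)
  have hF: "h x \<in> ?F" if x: "x \<in> ?F" for x
  proof -
    obtain f where f: "\<forall>k. f k \<in> core_algebra" "tends f x" using x mem_core_iff_tends by blast
    have "h (f k) \<in> core_algebra" for k using f(1) lvl unfolding core_algebra_def by blast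
    then show ?thesis using star_hom_tends[OF h f(2)]
      unfolding mem_core_iff_tends by (intro exI[of _ "\<lambda>k. h (f k)"] conjI allI)
  qed
  have im: "restrict h (carrier A) ` ?F = ?F"
  proof
    show "restrict h (carrier A) ` ?F \<subseteq> ?F" using hF core_subset by auto
    show "?F \<subseteq> restrict h (carrier A) ` ?F"
    proof
      fix x assume x: "x \<in> ?F"
      then have "x = restrict h (carrier A) (h x)" using hh[of x] hF[of x] core_subset by auto
      then show "x \<in> restrict h (carrier A) ` ?F" using hF[OF x] by blast
    qed
  qed
  have "bij_betw (restrict h (carrier A)) (carrier A) (carrier A)"
    by (rule bij_betw_byWitness[where f' = h]) (use hh D(1) in auto)
  moreover have "restrict h (carrier A) \<in> star_hom A A"
    by (rule star_homI) (simp_all add: D adj_closed)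
  ultimately show "restrict h (carrier A) \<in> Aut_pair A (core n A S)"
    using im by (simp add: Aut_pair_def Aut_def Bij_def)
  \<comment> \<open>In each summand the signs from \<open>S i\<close> and from its adjoint
    cancel.\<close>
  have h_shift: "h (shift x) = shift (h x)" if x: "x \<in> carrier A" for x
  proof -
    have "h (shift x) = (\<Oplus>i\<in>{1..n}. h (S i \<otimes> x \<otimes> adj A (S i)))"
      unfolding shift_def using x by (intro star_hom_finsum[OF h]) auto
    also have "\<dots> = shift (h x)"
      unfolding shift_def
    proof (intro finsum_cong')
      fix i assume i: "i \<in> {1..n}"
      have "h (S i \<otimes> x \<otimes> adj A (S i)) = h (S i) \<otimes> h x \<otimes> adj A (h (S i))"
        using i x D(2,6) by simp
      then show "h (S i \<otimes> x \<otimes> adj A (S i)) = S i \<otimes> h x \<otimes> adj A (S i)"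
        using i x D(1) hp hi[OF i] by (cases "i = p") (auto simp: adj_minus l_minus r_minus)
    qed (use x D(1) in auto)
    finally show ?thesis .
  qed
  have h_flip: "h flip = \<ominus> flip"
    using D(2,3,6) hp hi[OF q] p_neq_q by (simp add: flip_def adj_minus l_minus r_minus minus_add)
  have h_flip_at: "h (flip_at k) = \<ominus> flip_at k" for k
    by (induction k) (simp_all add: flip_at_def h_flip h_shift shift_minus)
  show "restriction_map (core n A S) (restrict h (carrier A)) \<notin> Inn (core n A S)"
  proof
    assume "restriction_map (core n A S) (restrict h (carrier A)) \<in> Inn (core n A S)"
    then obtain w where w: "w \<in> ?F" "adj A w \<otimes> w = \<one>"
      and eq: "restriction_map (core n A S) (restrict h (carrier A)) = Ad (core n A S) w"
      by (auto simp: Inn_def unitaries_def)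
    have wA: "w \<in> carrier A" "adj A w \<in> carrier A" using w core_subset adj_closed by auto
    \<comment> \<open>The equation for conjugation by \<open>w\<close> is multiplied by
      \<open>w\<close> on the right. Writing \<open>k + 0\<close> matches the offset c = 0.\<close>
    have rel: "w \<otimes> flip_at k = \<ominus> (flip_at (k + 0) \<otimes> w)" for k
    proof -
      have "w \<otimes> flip_at k \<otimes> adj A w = h (flip_at k)"
        using fun_cong[OF eq, of "flip_at k"] flip_at_in_core[of k]
        by (simp add: restriction_map_def Ad_def)
      then have "w \<otimes> flip_at k \<otimes> adj A w \<otimes> w = \<ominus> flip_at k \<otimes> w" by (simp add: h_flip_at)
      then show ?thesis using wA w(2) by (simp add: m_assoc l_minus)
    qed
    show False
      using rel by (intro no_isometry_anticommuting_with_flips[OF gen wA(1) w(2)]) blast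
  qed
qed

end

theorem mainTheorem2:
  fixes n :: nat and A :: "'a cstar" and S :: "nat \<Rightarrow> 'a"
  assumes "n \<ge> 2" and "cuntz_algebra n A S"
  shows "restriction_map (core n A S) \<in> Aut_pair A (core n A S) \<rightarrow> Aut (core n A S)
    \<and> restriction_map (core n A S) ` Aut_pair A (core n A S) \<noteq> Aut (core n A S)
    \<and> Inn (core n A S) \<subset> restriction_map (core n A S) ` Aut_pair A (core n A S)
    \<and> restriction_map (core n A S) ` Aut_pair A (core n A S) \<subset> Aut (core n A S)"
proof -
  interpret cuntz_algebra n A S by fact
  \<comment> \<open>\<open>n \<ge> 2\<close> supplies two distinct indices.\<close>
  interpret cuntz_pair n A S 1 2 by unfold_locales (use \<open>n \<ge> 2\<close> in auto)
  let ?F = "core n A S"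
  have maps: "restriction_map ?F \<in> Aut_pair A ?F \<rightarrow> Aut ?F"
    using restriction_map_in_Aut by auto
  have not_onto: "alt_aut \<in> Aut ?F" "alt_aut \<notin> restriction_map ?F ` Aut_pair A ?F"
    using alt_aut_in_Aut alt_aut_not_restriction[OF generated] by auto
  have inner: "Inn ?F \<subseteq> restriction_map ?F ` Aut_pair A ?F"
    using Ad_in_Aut_pair by (auto simp: Inn_def simp flip: restriction_map_Ad)
  \<comment> \<open>The universal property is applied with A itself as target and the family in
    which \<open>S 1\<close> is negated.\<close>
  obtain h where "h \<in> star_hom A A" "\<forall>i\<in>{1..n}. h (S i) = (S(1 := \<ominus>\<^bsub>A\<^esub> S 1)) i"
    using universal[OF cuntz_family_sign_change] by blast
  from sign_change_not_inner[OF generated this] have "Inn ?F \<noteq> restriction_map ?F ` Aut_pair A ?F"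
    by blast
  with maps not_onto inner show ?thesis by blast
qed

end
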